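(* Let $n\ge5$ be an integer, let $N=2^n$, and let $F\colon\mathbb F_2^n\to\mathbb F_2^n$ be an APN function. If $\sum_{x\in\mathbb F_2^n}F(x)=0$, then \[ \mathcal L(F)\le \begin{cases} N-12,& n\text{ even},\\ N-8,& n\text{ odd}. \end{cases} \] In particular, these bounds hold for every APN permutation $F$ of $\mathbb F_2^n$.
   Context: A function $F\colon\mathbb F_2^n\to\mathbb F_2^n$ is almost perfect nonlinear (APN) if for every $h\in\mathbb F_2^n\setminus\{0\}$ and every $y\in\mathbb F_2^n$ the equation $F(x+h)+F(x)=y$ has at most two solutions $x\in\mathbb F_2^n$. An APN permutation is a bijective APN function. For $b\in\mathbb F_2^n$ let $f_b=b\cdot F\colon\mathbb F_2^n\to\mathbb F_2$, where $\cdot$ is the usual dot product over $\mathbb F_2$. For a Boolean function $f\colon\mathbb F_2^n\to\mathbb F_2$ the Walsh transform is $W_f(a)=\sum_{x\in\mathbb F_2^n}(-1)^{f(x)+a\cdot x}$ for $a\in\mathbb F_2^n$. The linearity of $F$ is $\mathcal L(F)=\max\{|W_{f_b}(a)| : a\in\mathbb F_2^n,\ b\in\mathbb F_2^n\setminus\{0\}\}$. *)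

theory Defs
  imports "HOL-Analysis.Finite_Cartesian_Product" "HOL-Library.Z2"
begin

(* The library does not register the two-element field as a finite type. The instance is what
   makes bit ^ 'n a finite type, so that the card, sum and Max below range over finite sets. *)
instance bit :: finite
proof
  have "x \<in> {0, 1}" for x :: bit
    by (cases x) simp_all
  then have "(UNIV :: bit set) = {0, 1}"
    by blast
  moreover have "finite {0, 1 :: bit}"
    by blast
  ultimately show "finite (UNIV :: bit set)"
    by metis
qed

definition apn :: "(bit ^ 'n \<Rightarrow> bit ^ 'n) \<Rightarrow> bool" where
  "apn F \<longleftrightarrow> (\<forall>h y. h \<noteq> 0 \<longrightarrow> card {x. F (x + h) + F x = y} \<le> 2)"

definition component_fun :: "bit ^ 'n \<Rightarrow> (bit ^ 'n \<Rightarrow> bit ^ 'n) \<Rightarrow> bit ^ 'n \<Rightarrow> bit" where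
  "component_fun b F x = scalar_product b (F x)"

(* of_bit lifts the exponent from the two-element field to {0, 1} :: nat set. *)
definition walsh :: "(bit ^ 'n \<Rightarrow> bit) \<Rightarrow> bit ^ 'n \<Rightarrow> int" where
  "walsh f a = (\<Sum>x\<in>UNIV. (- 1) ^ of_bit (f x + scalar_product a x))"

definition linearity :: "(bit ^ 'n \<Rightarrow> bit ^ 'n) \<Rightarrow> int" where
  "linearity F = Max {\<bar>walsh (component_fun b F) a\<bar> | a b. b \<noteq> 0}"

end

theory Submission
  imports Defs
begin

text \<open>Let \<open>N = 2 ^ n\<close>. A Walsh coefficient of absolute value \<open>N - 2 k\<close> means that the component \<open>b \<odot> F\<close>
differs from an affine function in exactly \<open>k\<close> points. Adding an affine multiple of a vector \<open>e\<close> with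
\<open>b \<odot> e = 1\<close> turns \<open>F\<close> into an APN function \<open>G\<close> whose component \<open>b \<odot> G\<close> is the indicator function of a set \<open>S\<close>
of \<open>k\<close> points. Since the values of \<open>G\<close> sum to zero, \<open>k\<close> is even. The bounds say that \<open>k\<close> is neither \<open>0\<close> nor
\<open>2\<close>, and not \<open>4\<close> if \<open>n\<close> is even.

Over the complement of \<open>S\<close> the graph of \<open>G\<close> is a Sidon set \<open>A\<close> of size \<open>N - k\<close>, and it lies in a hyperplane of
the \<open>2 n\<close>-dimensional space. Let \<open>T a c\<close> be its character sum at the frequency \<open>(a, c)\<close>. It has two features
that contradict each other.

First, the Sidon property determines the second and the fourth moment of \<open>T\<close>. The columns \<open>c = 0\<close> and \<open>c = b\<close>
are explicitly known and carry a large part of the fourth moment. On the other columns the mean of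
\<open>(T\<^sup>2 - N)\<^sup>2\<close> is then only about \<open>4 k N\<close>: in the quadratic mean, \<open>\<bar>T\<bar>\<close> differs from the square root of \<open>N\<close> by
about the square root of \<open>k\<close>.

Secondly, \<open>T\<close> is confined to residue classes modulo \<open>4\<close>. Let \<open>\<sigma>\<close> be the sum of the graph points over \<open>S\<close>; then
\<open>T a c\<close> is congruent to \<open>N - k\<close> or to \<open>N - k + 2\<close> according to the inner product of \<open>(a, c)\<close> with \<open>\<sigma>\<close>. If
\<open>\<sigma> \<noteq> 0\<close>, both classes occur equally often, and \<open>T\<close> cannot be close to the square root of \<open>N\<close> on both. For two
consecutive admissible absolute values \<open>y\<close> and \<open>z\<close> the quartic \<open>(T\<^sup>2 - y\<^sup>2) * (T\<^sup>2 - z\<^sup>2)\<close> is nonnegative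
(\<open>gap_poly_nonneg\<close>). The moments determine or bound the sums of such quartics, and for the excluded values of
\<open>k\<close> they leave so little room that either a contradiction results or, on many frequencies, \<open>\<bar>T\<bar>\<close> takes only
the admissible values next to the square root of \<open>N\<close>.

The remaining rigid configurations fail for a divisibility reason that goes back to Nyberg's proof that there
are no vectorial bent functions into spaces of large dimension (\<open>nyberg\<close>): summing \<open>T a c\<close> for a fixed \<open>a\<close>
over a subspace of values of \<open>c\<close> gives a multiple of \<open>N / 4\<close>, but an odd number of summands, each plus or
minus the square root of \<open>N\<close>, does not have such a sum.

For \<open>k = 0\<close> and even \<open>n\<close> this applies directly; for odd \<open>n\<close> it is enough that \<open>N\<close> is not a square
(\<open>S_nonempty\<close>). For \<open>k = 2\<close>, if \<open>N\<close> is the square of a multiple of \<open>4\<close>, the quartics sum to zero and \<open>T\<^sup>2 = N\<close>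
on half of the rows; otherwise two choices of quartics together contradict the fact that \<open>N\<close> is a power of two
(\<open>S_not_pair\<close>). For \<open>k = 4\<close> there are two cases. If the four points of \<open>S\<close> have a nonzero sum, there is a row
\<open>a\<close> in which, off the two special columns, \<open>\<bar>T\<bar>\<close> differs from the square root of \<open>N\<close> by exactly \<open>2\<close>; the signs
of these deviations form a quadratic character, whose sum is so divisible that Nyberg's argument still works
(\<open>S_not_quadruple\<close>). If \<open>S\<close> is an affine plane, congruences modulo \<open>8\<close> in each column show that the fourth
moment is only just large enough, and equality leads back to Nyberg's argument
(\<open>flat_component.contradiction\<close>).\<close>

notation scalar_product (infixl "\<odot>" 70)

text \<open>Addition and multiplication of bits are used as ring operations, not as bitwise operations.\<close>

declare add_bit_eq_xor [simp del] mult_bit_eq_and [simp del]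

section \<open>Characters of binary vector spaces\<close>

text \<open>The nontrivial character of the two-element field, with integer values so that sums of it can be
studied modulo powers of two.\<close>

definition chi :: "bit \<Rightarrow> int" where
  "chi z = (if z = 0 then 1 else - 1)"

lemma chi_0 [simp]: "chi 0 = 1" and chi_1 [simp]: "chi 1 = - 1"
  by (simp_all add: chi_def)

lemma bit_add_self [simp]: "(x :: bit) + x = 0"
  by (cases x) (simp_all add: add_bit_eq_xor)

lemma chi_add: "chi (x + y) = chi x * chi y"
  by (cases x; cases y) simp_all

lemma chi_cases: "chi x = 1 \<or> chi x = - 1"
  by (simp add: chi_def)

lemma chi_sq [simp]: "chi x * chi x = 1" "(chi x)\<^sup>2 = 1"
  by (simp_all add: chi_def)

lemma chi_eq_1_iff [simp]: "chi x = 1 \<longleftrightarrow> x = 0"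
  by (cases x) simp_all

lemma abs_chi [simp]: "\<bar>chi x\<bar> = 1"
  by (simp add: chi_def)

lemma neg_one_power_of_bit: "(- 1) ^ of_bit x = chi x"
  by (cases x) simp_all

lemma vec_add_self [simp]: "(x :: bit ^ 'n) + x = 0"
  by (simp add: vec_eq_iff)

lemma vec_add_self_left [simp]: "(x :: bit ^ 'n) + (x + y) = y"
  by (simp flip: add.assoc)

lemma vec_add_self_right [simp]: "(x :: bit ^ 'n) + y + y = x"
  by (simp add: add.assoc)

lemma vec_add_eq_0_iff: "(x :: bit ^ 'n) + y = 0 \<longleftrightarrow> x = y"
  by (metis add_0_right vec_add_self vec_add_self_left)

lemma dot_commute: "(x :: bit ^ 'n) \<odot> y = y \<odot> x"
  by (simp add: scalar_product_def mult.commute)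

lemma dot_add_left: "((x :: bit ^ 'n) + y) \<odot> z = x \<odot> z + y \<odot> z"
  by (simp add: scalar_product_def distrib_right sum.distrib)

lemma dot_add_right: "(z :: bit ^ 'n) \<odot> (x + y) = z \<odot> x + z \<odot> y"
  by (simp add: scalar_product_def distrib_left sum.distrib)

lemma dot_0 [simp]: "(0 :: bit ^ 'n) \<odot> x = 0" "x \<odot> (0 :: bit ^ 'n) = 0"
  by (simp_all add: scalar_product_def)

lemma dot_scale_right: "(x :: bit ^ 'n) \<odot> (k *s y) = k * (x \<odot> y)"
  by (simp add: scalar_product_def vector_scalar_mult_def sum_distrib_left mult.left_commute)

lemma dot_sum_right: "(x :: bit ^ 'n) \<odot> (\<Sum>i\<in>I. f i) = (\<Sum>i\<in>I. x \<odot> f i)"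
  by (induction I rule: infinite_finite_induct) (simp_all add: dot_add_right)

lemma dot_axis: "(x :: bit ^ 'n) \<odot> axis i 1 = x $ i"
proof -
  have "x \<odot> axis i 1 = (\<Sum>j\<in>UNIV. if j = i then x $ j else 0)"
    unfolding scalar_product_def by (rule sum.cong) (auto simp: axis_def)
  then show ?thesis by simp
qed

lemma exists_dot_1:
  assumes "(x :: bit ^ 'n) \<noteq> 0"
  obtains e where "x \<odot> e = 1"
proof -
  obtain i where "x $ i \<noteq> 0"
    using assms by (auto simp: vec_eq_iff)
  then have "x \<odot> axis i 1 = 1"
    by (simp add: dot_axis)
  then show ?thesis using that by blast
qed

lemma sum_UNIV_shift: "(\<Sum>x\<in>UNIV. f (x + d)) = (\<Sum>x\<in>UNIV. f (x :: 'a :: {ab_group_add, finite}))"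
  by (rule sum.reindex_bij_witness[of _ "\<lambda>x. x - d" "\<lambda>x. x + d"]) auto

lemma card_bit [simp]: "CARD(bit) = 2"
proof -
  have "(UNIV :: bit set) = {0, 1}"
    by (auto intro: bit.exhaust)
  then show ?thesis
    by (metis card_2_iff zero_neq_one)
qed

lemma sum_chi_dot:
  "(\<Sum>a\<in>UNIV. chi (a \<odot> (x :: bit ^ 'n))) = (if x = 0 then 2 ^ CARD('n) else 0)"
proof (cases "x = 0")
  case True
  then show ?thesis by simp
next
  case False
  then obtain e where e: "x \<odot> e = 1" by (rule exists_dot_1)
  have "(\<Sum>a\<in>UNIV. chi (a \<odot> x)) = (\<Sum>a\<in>UNIV. chi ((a + e) \<odot> x))"
    by (rule sum_UNIV_shift[symmetric])
  also have "\<dots> = - (\<Sum>a\<in>UNIV. chi (a \<odot> x))"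
    using e by (simp add: dot_add_left chi_add dot_commute[of e] sum_negf)
  finally show ?thesis using False by simp
qed

text \<open>Two distinct nonzero vectors over the two-element field are linearly independent, so a functional
can separate them. Counting the solutions \<open>d\<close> with characters avoids bases.\<close>

lemma exists_dual:
  assumes "h1 \<noteq> 0" "h2 \<noteq> 0" "h1 \<noteq> (h2 :: bit ^ 'n)"
  obtains d where "d \<odot> h1 = 1" "d \<odot> h2 = 0"
proof (rule ccontr)
  assume no: "\<not> thesis"
  have "(1 - chi (d \<odot> h1)) * (1 + chi (d \<odot> h2)) = 0" for d
    using no that[of d] by (cases "d \<odot> h1 = 0"; cases "d \<odot> h2 = 0") simp_all
  then have "(\<Sum>d\<in>UNIV. 1 - chi (d \<odot> h1) + chi (d \<odot> h2) - chi (d \<odot> (h1 + h2))) = 0"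
    by (simp add: dot_add_right chi_add algebra_simps)
  then show False
    using assms by (simp add: sum.distrib sum_subtractf sum_chi_dot vec_add_eq_0_iff)
qed

lemma sum_chi_eq:
  assumes "finite X"
  shows "(\<Sum>x\<in>X. chi (f x)) = int (card X) - 2 * int (card {x \<in> X. f x = 1})"
proof -
  have "(\<Sum>x\<in>X. chi (f x)) = (\<Sum>x\<in>X. 1 - 2 * (if f x = 1 then 1 else 0))"
    by (intro sum.cong) (auto simp: chi_def)
  also have "\<dots> = int (card X) - 2 * int (card {x \<in> X. f x = 1})"
    using assms by (simp add: sum_subtractf Int_def conj_commute flip: sum_distrib_left sum.inter_filter)
  finally show ?thesis .
qed

lemma chi_sum_bits:
  assumes "finite X"
  shows "chi (\<Sum>x\<in>X. f x) = (- 1) ^ card {x \<in> X. f x = 1}"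
  using assms
proof (induction X)
  case empty
  then show ?case by simp
next
  case (insert x X)
  have "{y \<in> insert x X. f y = 1} = (if f x = 1 then insert x {y \<in> X. f y = 1} else {y \<in> X. f y = 1})"
    by auto
  then show ?case
    using insert by (cases "f x") (simp_all add: chi_add)
qed

text \<open>The number of points where \<open>f\<close> is one has the parity of the sum of \<open>f\<close>, and each such point lowers
the character sum by \<open>2\<close>.\<close>

lemma sum_chi_mod_4:
  assumes "finite X"
  shows "4 dvd (\<Sum>x\<in>X. chi (f x)) - int (card X) + 1 - chi (\<Sum>x\<in>X. f x)"
proof -
  have eq: "(\<Sum>x\<in>X. chi (f x)) - int (card X) + 1 - chi (\<Sum>x\<in>X. f x)
      = 1 - (- 1) ^ card {x \<in> X. f x = 1} - 2 * int (card {x \<in> X. f x = 1})"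
    by (simp add: sum_chi_eq[OF assms] chi_sum_bits[OF assms])
  moreover have "4 dvd 1 - (- 1) ^ w - 2 * int w" for w
  proof (cases "even w")
    case True
    then show ?thesis by (auto elim!: evenE)
  next
    case False
    then obtain j where "w = 2 * j + 1" by (elim oddE)
    then have "1 - (- 1) ^ w - 2 * int w = 4 * (- int j)" by simp
    then show ?thesis by (metis dvd_triv_left)
  qed
  ultimately show ?thesis unfolding eq by blast
qed

text \<open>Changing \<open>f\<close> by \<open>g\<close> flips the signs on the support of \<open>g\<close>, and there the previous congruence
applies. The last term is a character in every parameter on which \<open>f\<close> depends linearly: this is where
quadratic behaviour modulo \<open>8\<close> comes from.\<close>

lemma sum_chi_add_mod_8:
  assumes "finite X"
  shows "8 dvd (\<Sum>x\<in>X. chi (f x + g x)) - (\<Sum>x\<in>X. chi (f x)) + 2 * int (card {x \<in> X. g x = 1})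
                - 2 + 2 * chi (\<Sum>x | x \<in> X \<and> g x = 1. f x)"
proof -
  let ?Y = "{x \<in> X. g x = 1}"
  have "(\<Sum>x\<in>X. chi (f x + g x)) = (\<Sum>x\<in>X. chi (f x) - 2 * (if g x = 1 then chi (f x) else 0))"
    by (intro sum.cong) (auto simp: chi_add)
  also have "\<dots> = (\<Sum>x\<in>X. chi (f x)) - 2 * (\<Sum>x\<in>?Y. chi (f x))"
    using assms by (simp add: sum_subtractf flip: sum_distrib_left sum.inter_filter)
  finally have "(\<Sum>x\<in>X. chi (f x + g x)) - (\<Sum>x\<in>X. chi (f x)) + 2 * int (card ?Y) - 2 + 2 * chi (\<Sum>x\<in>?Y. f x)
      = - 2 * ((\<Sum>x\<in>?Y. chi (f x)) - int (card ?Y) + 1 - chi (\<Sum>x\<in>?Y. f x))"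
    by simp
  moreover obtain j where "(\<Sum>x\<in>?Y. chi (f x)) - int (card ?Y) + 1 - chi (\<Sum>x\<in>?Y. f x) = 4 * j"
    using sum_chi_mod_4[of ?Y f] assms by (auto elim: dvdE)
  ultimately have "(\<Sum>x\<in>X. chi (f x + g x)) - (\<Sum>x\<in>X. chi (f x)) + 2 * int (card ?Y) - 2 + 2 * chi (\<Sum>x\<in>?Y. f x)
      = 8 * (- j)"
    by simp
  then show ?thesis
    by (metis dvd_triv_left)
qed

lemma sum_vec_UNIV:
  assumes "CARD('n) \<ge> 2"
  shows "(\<Sum>x\<in>UNIV. x) = (0 :: bit ^ 'n)"
proof -
  have "chi ((\<Sum>x\<in>UNIV. x :: bit ^ 'n) $ i) = 1" for i
  proof -
    have "int (card (UNIV :: (bit ^ 'n) set)) - 2 * int (card {x \<in> UNIV. (x :: bit ^ 'n) $ i = 1}) = 0"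
      using sum_chi_dot[of "axis i 1 :: bit ^ 'n"] sum_chi_eq[of "UNIV :: (bit ^ 'n) set" "\<lambda>x. x $ i"]
      by (simp add: dot_axis axis_eq_0_iff)
    then have "int (2 * card {x \<in> UNIV. (x :: bit ^ 'n) $ i = 1}) = int (2 ^ CARD('n))"
      by simp
    then have "2 * card {x \<in> UNIV. (x :: bit ^ 'n) $ i = 1} = 2 ^ CARD('n)"
      by (simp only: of_nat_eq_iff)
    also have "\<dots> = 2 * (2 * 2 ^ (CARD('n) - 2))"
      using assms by (simp flip: power_Suc add: Suc_diff_Suc numeral_2_eq_2)
    finally have "even (card {x \<in> UNIV. (x :: bit ^ 'n) $ i = 1})"
      by simp
    then show ?thesis
      unfolding sum_component chi_sum_bits[OF finite] by simp
  qed
  then show ?thesis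
    by (simp add: vec_eq_iff)
qed

definition pair_dot :: "(bit ^ 'n) \<times> (bit ^ 'n) \<Rightarrow> (bit ^ 'n) \<times> (bit ^ 'n) \<Rightarrow> bit" (infixl "\<diamondop>" 70) where
  "u \<diamondop> z = fst u \<odot> fst z + snd u \<odot> snd z"

lemma pair_dot_add_left: "(u + v) \<diamondop> z = u \<diamondop> z + v \<diamondop> z"
  by (simp add: pair_dot_def dot_add_left add_ac)

lemma pair_dot_add_right: "u \<diamondop> (y + z) = u \<diamondop> y + u \<diamondop> z"
  by (simp add: pair_dot_def dot_add_right add_ac)

lemma pair_add_self [simp]: "(z :: (bit ^ 'n) \<times> (bit ^ 'n)) + z = 0"
  by (simp add: prod_eq_iff)

lemma pair_add_self_left [simp]: "(x :: (bit ^ 'n) \<times> (bit ^ 'n)) + (x + y) = y"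
  by (simp flip: add.assoc)

lemma pair_add_eq_0_iff: "(x :: (bit ^ 'n) \<times> (bit ^ 'n)) + y = 0 \<longleftrightarrow> x = y"
  by (metis add_0_right pair_add_self pair_add_self_left)

lemma sum_pairs: "(\<Sum>u\<in>UNIV. f u) = (\<Sum>a\<in>UNIV. \<Sum>c\<in>UNIV. f (a, c))"
  by (simp add: sum.cartesian_product flip: UNIV_Times_UNIV)

lemma sum_chi_pair_dot:
  "(\<Sum>u\<in>UNIV. chi (u \<diamondop> (z :: (bit ^ 'n) \<times> (bit ^ 'n)))) = (if z = 0 then (2 ^ CARD('n))\<^sup>2 else 0)"
proof -
  have "(\<Sum>u\<in>UNIV. chi (u \<diamondop> z)) = (\<Sum>a\<in>UNIV. chi (a \<odot> fst z)) * (\<Sum>c\<in>UNIV. chi (c \<odot> snd z))"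
    by (simp add: sum_pairs pair_dot_def chi_add sum_product)
  then show ?thesis
    by (simp add: sum_chi_dot prod_eq_iff power2_eq_square)
qed

definition fourier :: "((bit ^ 'n) \<times> (bit ^ 'n) \<Rightarrow> int) \<Rightarrow> (bit ^ 'n) \<times> (bit ^ 'n) \<Rightarrow> int" where
  "fourier f u = (\<Sum>z\<in>UNIV. f z * chi (u \<diamondop> z))"

lemma parseval:
  fixes f g :: "(bit ^ 'n) \<times> (bit ^ 'n) \<Rightarrow> int"
  shows "(\<Sum>u\<in>UNIV. fourier f u * fourier g u * chi (u \<diamondop> w))
           = (2 ^ CARD('n))\<^sup>2 * (\<Sum>z\<in>UNIV. f z * g (z + w))"
proof -
  have "(\<Sum>u\<in>UNIV. fourier f u * fourier g u * chi (u \<diamondop> w))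
      = (\<Sum>u\<in>UNIV. \<Sum>y\<in>UNIV. \<Sum>z\<in>UNIV. f y * g z * chi (u \<diamondop> (y + z + w)))"
    unfolding fourier_def sum_product unfolding sum_distrib_right pair_dot_add_right chi_add
    by (intro sum.cong refl) (simp add: algebra_simps)
  also have "\<dots> = (\<Sum>y\<in>UNIV. \<Sum>u\<in>UNIV. \<Sum>z\<in>UNIV. f y * g z * chi (u \<diamondop> (y + z + w)))"
    by (rule sum.swap)
  also have "\<dots> = (\<Sum>y\<in>UNIV. \<Sum>z\<in>UNIV. \<Sum>u\<in>UNIV. f y * g z * chi (u \<diamondop> (y + z + w)))"
    by (rule sum.cong[OF refl], rule sum.swap)
  also have "\<dots> = (\<Sum>y\<in>UNIV. \<Sum>z\<in>UNIV. f y * g z * (if y + z + w = 0 then (2 ^ CARD('n))\<^sup>2 else 0))"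
    by (simp add: sum_chi_pair_dot flip: sum_distrib_left)
  also have "\<dots> = (\<Sum>y\<in>UNIV. \<Sum>z\<in>UNIV. if z = y + w then (2 ^ CARD('n))\<^sup>2 * (f y * g z) else 0)"
  proof (intro sum.cong refl)
    fix y z :: "(bit ^ 'n) \<times> (bit ^ 'n)"
    have "y + z + w = 0 \<longleftrightarrow> z = y + w"
      using pair_add_eq_0_iff[of z "y + w"] by (simp add: add_ac)
    then show "f y * g z * (if y + z + w = 0 then (2 ^ CARD('n))\<^sup>2 else 0)
        = (if z = y + w then (2 ^ CARD('n))\<^sup>2 * (f y * g z) else 0)" by simp
  qed
  also have "\<dots> = (2 ^ CARD('n))\<^sup>2 * (\<Sum>z\<in>UNIV. f z * g (z + w))"
    by (simp add: sum_distrib_left)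
  finally show ?thesis .
qed

section \<open>Moments of the Fourier transform of a Sidon set\<close>

text \<open>Sums and differences coincide, so an element \<open>p\<close> of this set stands for the ordered representation
\<open>z = p + (p + z)\<close> with both summands in \<open>A\<close>.\<close>

definition rep :: "((bit ^ 'n) \<times> (bit ^ 'n)) set \<Rightarrow> (bit ^ 'n) \<times> (bit ^ 'n) \<Rightarrow> int" where
  "rep A z = int (card {p \<in> A. p + z \<in> A})"

definition sidon :: "((bit ^ 'n) \<times> (bit ^ 'n)) set \<Rightarrow> bool" where
  "sidon A \<longleftrightarrow> (\<forall>z. z \<noteq> 0 \<longrightarrow> rep A z \<le> 2)"

definition char_sum :: "((bit ^ 'n) \<times> (bit ^ 'n)) set \<Rightarrow> (bit ^ 'n) \<times> (bit ^ 'n) \<Rightarrow> int" where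
  "char_sum A u = (\<Sum>z\<in>A. chi (u \<diamondop> z))"

lemma char_sum_eq_fourier: "char_sum A u = fourier (\<lambda>z. of_bool (z \<in> A)) u"
proof -
  have "fourier (\<lambda>z. of_bool (z \<in> A)) u = (\<Sum>z\<in>UNIV. if z \<in> A then chi (u \<diamondop> z) else 0)"
    unfolding fourier_def by (intro sum.cong) auto
  then show ?thesis
    by (simp add: char_sum_def sum.If_cases)
qed

lemma rep_eq_sum: "rep A z = (\<Sum>p\<in>UNIV. of_bool (p \<in> A) * of_bool (p + z \<in> A))"
proof -
  have "(\<Sum>p\<in>UNIV. of_bool (p \<in> A) * of_bool (p + z \<in> A)) = (\<Sum>p\<in>UNIV. if p \<in> {p \<in> A. p + z \<in> A} then 1 else 0 :: int)"
    by (intro sum.cong) auto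
  also have "\<dots> = int (card {p \<in> A. p + z \<in> A})"
    by (subst sum.If_cases) auto
  finally show ?thesis
    by (simp add: rep_def)
qed

lemma second_moment:
  "(\<Sum>u\<in>UNIV. (char_sum A u)\<^sup>2 * chi (u \<diamondop> (z :: (bit ^ 'n) \<times> (bit ^ 'n)))) = (2 ^ CARD('n))\<^sup>2 * rep A z"
  unfolding char_sum_eq_fourier power2_eq_square[of "fourier _ _"] parseval rep_eq_sum ..

text \<open>The square of the transform of an indicator function is the transform of its self-convolution.
With Parseval's identity this turns the fourth moment into a correlation of \<open>rep A\<close>.\<close>

lemma char_sum_sq: "(char_sum A u)\<^sup>2 = fourier (rep A) u"
proof -
  have "(char_sum A u)\<^sup>2 = (\<Sum>p\<in>UNIV. \<Sum>q\<in>UNIV. of_bool (p \<in> A) * of_bool (q \<in> A) * chi (u \<diamondop> (p + q)))"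
    unfolding char_sum_eq_fourier fourier_def power2_eq_square sum_product pair_dot_add_right chi_add
    by (intro sum.cong refl) (simp add: algebra_simps)
  also have "\<dots> = (\<Sum>p\<in>UNIV. \<Sum>z\<in>UNIV. of_bool (p \<in> A) * of_bool (p + z \<in> A) * chi (u \<diamondop> z))"
  proof (rule sum.cong[OF refl])
    fix p
    show "(\<Sum>q\<in>UNIV. of_bool (p \<in> A) * of_bool (q \<in> A) * chi (u \<diamondop> (p + q)))
        = (\<Sum>z\<in>UNIV. of_bool (p \<in> A) * of_bool (p + z \<in> A) * chi (u \<diamondop> z))"
      by (rule sum.reindex_bij_witness[of _ "\<lambda>z. p + z" "\<lambda>z. p + z"]) auto
  qed
  also have "\<dots> = fourier (rep A) u"
    unfolding fourier_def rep_eq_sum sum_distrib_right by (rule sum.swap)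
  finally show ?thesis .
qed

lemma fourth_moment:
  "(\<Sum>u\<in>UNIV. (char_sum A u) ^ 4 * chi (u \<diamondop> (w :: (bit ^ 'n) \<times> (bit ^ 'n))))
     = (2 ^ CARD('n))\<^sup>2 * (\<Sum>z\<in>UNIV. rep A z * rep A (z + w))"
proof -
  have "(char_sum A u) ^ 4 = fourier (rep A) u * fourier (rep A) u" for u
    by (simp flip: char_sum_sq add: power2_eq_square power4_eq_xxxx mult_ac)
  then show ?thesis
    by (simp add: parseval)
qed

lemma rep_0 [simp]: "rep A 0 = int (card A)"
  by (simp add: rep_def)

text \<open>The translation by \<open>z\<close> pairs up the representations of \<open>z\<close>, so one of them entails a second
one.\<close>

lemma sidon_rep_cases:
  assumes "sidon A" "z \<noteq> 0"
  shows "rep A z = 0 \<or> rep A z = 2"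
proof (cases "{p \<in> A. p + z \<in> A} = {}")
  case True
  then show ?thesis by (simp only: rep_def) simp
next
  case False
  then obtain p where p: "p \<in> A" "p + z \<in> A" by blast
  then have "{p, p + z} \<subseteq> {p \<in> A. p + z \<in> A}"
    by (auto simp: add.assoc)
  then have "card {p, p + z} \<le> card {p \<in> A. p + z \<in> A}"
    by (intro card_mono) auto
  moreover have "card {p, p + z} = 2"
    using assms(2) by simp
  moreover have "rep A z \<le> 2"
    using assms unfolding sidon_def by blast
  ultimately show ?thesis
    unfolding rep_def by linarith
qed

lemma sum_rep: "(\<Sum>z\<in>UNIV. rep A z) = (int (card A))\<^sup>2"
proof -
  have "(\<Sum>z\<in>UNIV. rep A z) = (\<Sum>p\<in>UNIV. \<Sum>z\<in>UNIV. of_bool (p \<in> A) * of_bool (p + z \<in> A))"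
    unfolding rep_eq_sum by (rule sum.swap)
  also have "\<dots> = (\<Sum>p\<in>UNIV. \<Sum>q\<in>UNIV. of_bool (p \<in> A) * of_bool (q \<in> A))"
  proof (rule sum.cong[OF refl])
    fix p
    show "(\<Sum>z\<in>UNIV. of_bool (p \<in> A) * of_bool (p + z \<in> A))
        = (\<Sum>q\<in>UNIV. of_bool (p \<in> A) * of_bool (q \<in> A) :: int)"
      by (rule sum.reindex_bij_witness[of _ "\<lambda>z. p + z" "\<lambda>z. p + z"]) auto
  qed
  also have "\<dots> = (int (card A))\<^sup>2"
    unfolding sum_product[symmetric] by (simp add: power2_eq_square)
  finally show ?thesis .
qed

lemma sidon_sum_rep_sq:
  assumes "sidon A"
  shows "(\<Sum>z\<in>UNIV. rep A z * rep A z) = 3 * (int (card A))\<^sup>2 - 2 * int (card A)"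
proof -
  have "rep A z * rep A z = 2 * rep A z" if "z \<noteq> 0" for z
    using sidon_rep_cases[OF assms that] by auto
  then have "(\<Sum>z\<in>UNIV - {0}. rep A z * rep A z) = 2 * (\<Sum>z\<in>UNIV - {0}. rep A z)"
    unfolding sum_distrib_left by (intro sum.cong) auto
  moreover have "(\<Sum>z\<in>UNIV. rep A z * rep A z) = rep A 0 * rep A 0 + (\<Sum>z\<in>UNIV - {0}. rep A z * rep A z)"
    and "(\<Sum>z\<in>UNIV. rep A z) = rep A 0 + (\<Sum>z\<in>UNIV - {0}. rep A z)"
    by (rule sum.remove; simp)+
  ultimately show ?thesis
    by (simp add: sum_rep power2_eq_square)
qed

text \<open>All moment computations below are instances of this formula. The terms with \<open>chi (u \<diamondop> \<sigma>)\<close> serve to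
restrict a sum to the frequencies \<open>u\<close> on one side of the hyperplane orthogonal to \<open>\<sigma>\<close>.\<close>

lemma sidon_quartic_sum:
  fixes \<sigma> :: "(bit ^ 'n) \<times> (bit ^ 'n)"
  assumes "sidon A" "\<sigma> \<noteq> 0"
  defines "v \<equiv> int (card A)"
  shows "(\<Sum>u\<in>UNIV. p * char_sum A u ^ 4 + q * (char_sum A u)\<^sup>2 + r
            + (p' * char_sum A u ^ 4 + q' * (char_sum A u)\<^sup>2 + r') * chi (u \<diamondop> \<sigma>))
     = (2 ^ CARD('n))\<^sup>2 * (p * (3 * v\<^sup>2 - 2 * v) + q * v + r
          + p' * (\<Sum>z\<in>UNIV. rep A z * rep A (z + \<sigma>)) + q' * rep A \<sigma>)"
proof -
  have [simp]: "u \<diamondop> (0 :: (bit ^ 'n) \<times> (bit ^ 'n)) = 0" for u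
    by (simp add: pair_dot_def)
  have m4: "(\<Sum>u\<in>UNIV. char_sum A u ^ 4) = (2 ^ CARD('n))\<^sup>2 * (3 * v\<^sup>2 - 2 * v)"
    using fourth_moment[of A 0] sidon_sum_rep_sq[OF assms(1)] by (simp add: v_def)
  have m2: "(\<Sum>u\<in>UNIV. (char_sum A u)\<^sup>2) = (2 ^ CARD('n))\<^sup>2 * v"
    using second_moment[of A 0] by (simp add: v_def)
  have m0: "(\<Sum>u\<in>(UNIV :: ((bit ^ 'n) \<times> (bit ^ 'n)) set). 1) = ((2 ^ CARD('n))\<^sup>2 :: int)"
    using sum_chi_pair_dot[of "0 :: (bit ^ 'n) \<times> (bit ^ 'n)"] by (simp del: sum_constant)
  have "(\<Sum>u\<in>UNIV. p * char_sum A u ^ 4 + q * (char_sum A u)\<^sup>2 + r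
            + (p' * char_sum A u ^ 4 + q' * (char_sum A u)\<^sup>2 + r') * chi (u \<diamondop> \<sigma>))
     = p * (\<Sum>u\<in>UNIV. char_sum A u ^ 4) + q * (\<Sum>u\<in>UNIV. (char_sum A u)\<^sup>2)
       + r * (\<Sum>u\<in>(UNIV :: ((bit ^ 'n) \<times> (bit ^ 'n)) set). 1)
       + p' * (\<Sum>u\<in>UNIV. char_sum A u ^ 4 * chi (u \<diamondop> \<sigma>))
       + q' * (\<Sum>u\<in>UNIV. (char_sum A u)\<^sup>2 * chi (u \<diamondop> \<sigma>)) + r' * (\<Sum>u\<in>UNIV. chi (u \<diamondop> \<sigma>))"
    unfolding sum_distrib_left sum.distrib[symmetric]
    by (intro sum.cong) (simp_all add: algebra_simps)
  then show ?thesis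
    unfolding m4 m2 m0 fourth_moment second_moment sum_chi_pair_dot
    using assms(2) by (simp add: algebra_simps)
qed

section \<open>Integer inequalities and divisibility\<close>

lemma even_exponent_of_square:
  assumes "(2 :: int) ^ n = w\<^sup>2"
  shows "even n"
  using assms
proof (induction n arbitrary: w rule: less_induct)
  case (less n)
  show ?case
  proof (cases "n \<le> 1")
    case True
    show ?thesis
    proof (rule ccontr)
      assume "odd n"
      with True have "n = 1" by (cases n) auto
      with less.prems have w: "w\<^sup>2 = 2" by simp
      then have "even w" by (metis even_power even_numeral pos2)
      then obtain u where "w = 2 * u" by (elim evenE)
      with w have "2 * u\<^sup>2 = 1" by (simp add: power_mult_distrib)
      then show False by presburger
    qed
  next
    case False
    then obtain m where m: "n = m + 2" by (metis add.commute le_iff_add not_less_eq_eq numeral_2_eq_2 One_nat_def)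
    with less.prems have "even (w\<^sup>2)" by (metis even_power even_numeral zero_less_iff_neq_zero add_is_0 zero_neq_numeral)
    then have "even w" by simp
    then obtain u where "w = 2 * u" by (elim evenE)
    with less.prems m have "2 ^ m = u\<^sup>2" by (simp add: power_mult_distrib power_add)
    then have "even m" using less.IH m by simp
    then show ?thesis using m by simp
  qed
qed

text \<open>Since \<open>d\<close> divides \<open>2 * x\<close>, also \<open>\<bar>t\<bar>\<close> is congruent to \<open>x\<close> modulo \<open>d\<close>, so it does not lie strictly
between \<open>x\<close> and \<open>y\<close>.\<close>

lemma gap_poly_nonneg:
  fixes t x y d :: int
  assumes "0 \<le> x" "x \<le> y" "y \<le> x + d" "d dvd 2 * x" "d dvd t - x"
  shows "0 \<le> (t\<^sup>2 - x\<^sup>2) * (t\<^sup>2 - y\<^sup>2)"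
proof (cases "\<bar>t\<bar> \<le> x")
  case True
  then have "t\<^sup>2 \<le> x\<^sup>2" "t\<^sup>2 \<le> y\<^sup>2"
    using assms by (simp_all flip: abs_le_square_iff)
  then show ?thesis by (simp add: mult_nonpos_nonpos)
next
  case False
  have "d dvd - t - x"
    using dvd_add[OF assms(4,5)] by (simp add: dvd_diff_commute algebra_simps flip: dvd_minus_iff[of d "- t - x"])
  with assms(5) have "d dvd \<bar>t\<bar> - x"
    by (simp add: abs_if)
  then have "d \<le> \<bar>t\<bar> - x"
    using False by (intro zdvd_imp_le) auto
  then have "x\<^sup>2 \<le> t\<^sup>2" "y\<^sup>2 \<le> t\<^sup>2"
    using assms by (simp_all flip: abs_le_square_iff)
  then show ?thesis by simp
qed

lemma nat_sqrt_bracket: "\<exists>j :: nat. j\<^sup>2 \<le> m \<and> m < (j + 1)\<^sup>2"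
proof (induction m)
  case 0
  then show ?case by (intro exI[of _ 0]) simp
next
  case (Suc m)
  then obtain j where j: "j\<^sup>2 \<le> m" "m < (j + 1)\<^sup>2" by blast
  show ?case
  proof (cases "Suc m < (j + 1)\<^sup>2")
    case True
    with j show ?thesis by (intro exI[of _ j]) simp
  next
    case False
    with j have "Suc m = (j + 1)\<^sup>2" by simp
    then show ?thesis by (intro exI[of _ "j + 1"]) (simp add: power2_eq_square)
  qed
qed

lemma power_dvd_of_square:
  "(2 :: int) ^ (2 * m + 1) dvd x\<^sup>2 \<Longrightarrow> 2 ^ (m + 1) dvd x"
proof (induction m arbitrary: x)
  case 0
  then show ?case by simp
next
  case (Suc m)
  have "(2 :: int) dvd 2 ^ (2 * Suc m + 1)" by simp
  then have "2 dvd x\<^sup>2" using Suc.prems by (rule dvd_trans)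
  then have "even x" by simp
  then obtain y where y: "x = 2 * y" by (elim evenE)
  have "4 * 2 ^ (2 * m + 1) dvd 4 * y\<^sup>2"
    using Suc.prems by (simp add: y power_mult_distrib)
  then have "2 ^ (2 * m + 1) dvd y\<^sup>2" by (simp add: dvd_mult_cancel_left del: power_Suc power_add)
  then have "2 ^ (m + 1) dvd y" by (rule Suc.IH)
  then obtain k where "y = 2 ^ (m + 1) * k" by (elim dvdE)
  then have "x = 2 ^ (Suc m + 1) * k" by (simp add: y)
  then show ?case by (rule dvdI)
qed

text \<open>The absolute values admissible for \<open>t\<close> next after \<open>s - 2\<close> and \<open>s + 2\<close> are \<open>s - 6\<close> and
\<open>s + 6\<close>.\<close>

lemma gap_poly_large:
  fixes s t :: int
  assumes "8 dvd s" "8 \<le> s" "4 dvd t - 2" "t\<^sup>2 \<noteq> (s - 2)\<^sup>2" "t\<^sup>2 \<noteq> (s + 2)\<^sup>2"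
  shows "48 * s\<^sup>2 \<le> (t\<^sup>2 - (s - 2)\<^sup>2) * (t\<^sup>2 - (s + 2)\<^sup>2)"
proof -
  have lower: "48 * s\<^sup>2 \<le> x * y" if "8 * s - 32 \<le> x" "16 * s - 32 \<le> y" for x y
  proof -
    have "0 \<le> (s - 8) * (5 * s - 8)" using assms(2) by simp
    then have "48 * s\<^sup>2 \<le> (8 * s - 32) * (16 * s - 32)"
      by (simp add: power2_eq_square algebra_simps)
    also have "\<dots> \<le> x * y"
      using that assms(2) by (intro mult_mono) auto
    finally show ?thesis .
  qed
  have ne: "\<bar>t\<bar> \<noteq> s - 2" "\<bar>t\<bar> \<noteq> s + 2"
    using assms(4,5) by (metis power2_abs)+
  have "4 dvd \<bar>t\<bar> - 2" using assms(3) by presburger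
  with ne assms(1) have "\<bar>t\<bar> \<le> s - 6 \<or> \<bar>t\<bar> \<ge> s + 6" by presburger
  then consider "\<bar>t\<bar> \<le> s - 6" | "\<bar>t\<bar> \<ge> s + 6" by blast
  then show ?thesis
  proof cases
    case 1
    then have "t\<^sup>2 \<le> (s - 6)\<^sup>2"
      using assms(2) by (simp flip: abs_le_square_iff)
    then have "48 * s\<^sup>2 \<le> ((s - 2)\<^sup>2 - t\<^sup>2) * ((s + 2)\<^sup>2 - t\<^sup>2)"
      by (intro lower) (simp_all add: power2_eq_square algebra_simps)
    then show ?thesis by (simp add: algebra_simps)
  next
    case 2
    then have "(s + 6)\<^sup>2 \<le> t\<^sup>2"
      using assms(2) by (simp flip: abs_le_square_iff)
    then have "48 * s\<^sup>2 \<le> (t\<^sup>2 - (s + 2)\<^sup>2) * (t\<^sup>2 - (s - 2)\<^sup>2)"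
      by (intro lower) (simp_all add: power2_eq_square algebra_simps)
    then show ?thesis by (simp add: mult.commute)
  qed
qed

section \<open>APN functions with a sparse component\<close>

text \<open>The normal form of an APN function with a large Walsh coefficient. The number \<open>N\<close> is a parameter
with a defining equation so that it stays folded during the polynomial computations.\<close>

locale sparse_component =
  fixes G :: "bit ^ 'n \<Rightarrow> bit ^ 'n" and b :: "bit ^ 'n" and S :: "(bit ^ 'n) set" and N :: int
  assumes apn: "apn G"
    and sum_G: "(\<Sum>x\<in>UNIV. G x) = 0"
    and b_nonzero: "b \<noteq> 0"
    and component: "b \<odot> G x = of_bool (x \<in> S)"
    and dim: "CARD('n) \<ge> 5"
    and N_def: "N = 2 ^ CARD('n)"
begin

lemma sum_chi_dot_N: "(\<Sum>a\<in>UNIV. chi (a \<odot> (x :: bit ^ 'n))) = (if x = 0 then N else 0)"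
  by (simp add: sum_chi_dot N_def)

text \<open>The graph is cut down to the part on which \<open>b \<odot> G\<close> vanishes, so that it lies in a
hyperplane.\<close>

definition A :: "((bit ^ 'n) \<times> (bit ^ 'n)) set" where
  "A = (\<lambda>x. (x, G x)) ` (- S)"

definition T :: "bit ^ 'n \<Rightarrow> bit ^ 'n \<Rightarrow> int" where
  "T a c = char_sum A (a, c)"

definition \<sigma>1 :: "bit ^ 'n" where "\<sigma>1 = (\<Sum>x\<in>S. x)"
definition \<sigma>2 :: "bit ^ 'n" where "\<sigma>2 = (\<Sum>x\<in>S. G x)"

lemma T_eq: "T a c = (\<Sum>x\<in>- S. chi (a \<odot> x + c \<odot> G x))"
  unfolding T_def A_def char_sum_def
  by (subst sum.reindex) (auto simp: inj_on_def pair_dot_def)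

lemma card_A: "int (card A) = N - int (card S)"
proof -
  have "card A = card (- S)"
    unfolding A_def by (intro card_image) (auto simp: inj_on_def)
  moreover have "card S \<le> card (UNIV :: (bit ^ 'n) set)"
    by (intro card_mono) auto
  ultimately show ?thesis
    by (simp add: Compl_eq_Diff_UNIV card_Diff_subset of_nat_diff N_def)
qed

lemma mem_A: "(x, y) \<in> A \<longleftrightarrow> x \<notin> S \<and> y = G x"
  by (auto simp: A_def)

lemma rep_A: "rep A (p, q) = int (card {x. x \<notin> S \<and> x + p \<notin> S \<and> G (x + p) + G x = q})"
proof -
  have "{z \<in> A. z + (p, q) \<in> A} = (\<lambda>x. (x, G x)) ` {x. x \<notin> S \<and> x + p \<notin> S \<and> G (x + p) + G x = q}"
  proof (intro set_eqI iffI)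
    fix z assume "z \<in> {z \<in> A. z + (p, q) \<in> A}"
    then have "z \<in> A" "z + (p, q) \<in> A" by auto
    then obtain x where x: "z = (x, G x)" "x \<notin> S" "x + p \<notin> S" "G x + q = G (x + p)"
      by (auto simp: A_def)
    then have "G (x + p) + G x = q"
      by (metis add.commute vec_add_self_left)
    with x show "z \<in> (\<lambda>x. (x, G x)) ` {x. x \<notin> S \<and> x + p \<notin> S \<and> G (x + p) + G x = q}"
      by blast
  next
    fix z assume "z \<in> (\<lambda>x. (x, G x)) ` {x. x \<notin> S \<and> x + p \<notin> S \<and> G (x + p) + G x = q}"
    then show "z \<in> {z \<in> A. z + (p, q) \<in> A}"
      by (auto simp: mem_A add.left_commute[of "G _" "G _" "G _"] add.commute[of "G _" "G _"])
  qed
  then show ?thesis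
    unfolding rep_def by (simp add: card_image inj_on_def)
qed

lemma card_derivative_fibre: "h \<noteq> 0 \<Longrightarrow> card {x. G (x + h) + G x = y} \<le> 2"
  using apn unfolding apn_def by blast

lemma sidon_A: "sidon A"
  unfolding sidon_def
proof (intro allI impI)
  fix z :: "(bit ^ 'n) \<times> (bit ^ 'n)" assume z: "z \<noteq> 0"
  obtain p q where pq: "z = (p, q)" by (cases z)
  show "rep A z \<le> 2"
  proof (cases "p = 0")
    case True
    with z pq have "{x. x \<notin> S \<and> x + p \<notin> S \<and> G (x + p) + G x = q} = {}"
      by (auto simp: zero_prod_def)
    then show ?thesis unfolding pq rep_A by (simp only: card.empty)
  next
    case False
    have "card {x. x \<notin> S \<and> x + p \<notin> S \<and> G (x + p) + G x = q} \<le> card {x. G (x + p) + G x = q}"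
      by (intro card_mono) auto
    then show ?thesis unfolding pq rep_A using card_derivative_fibre[OF False, of q] by linarith
  qed
qed

text \<open>The elements of \<open>A\<close> lie in the hyperplane orthogonal to \<open>(0, b)\<close>.\<close>

lemma T_add_b: "T a (c + b) = T a c"
  unfolding T_eq by (intro sum.cong) (auto simp: dot_add_left component)

lemma T_b: "T a b = T a 0"
  using T_add_b[of a 0] by simp

lemma T_0: "T a 0 = (if a = 0 then N else 0) - (\<Sum>x\<in>S. chi (a \<odot> x))"
proof -
  have "(\<Sum>x\<in>- S. chi (a \<odot> x)) = (\<Sum>x\<in>UNIV. chi (a \<odot> x)) - (\<Sum>x\<in>S. chi (a \<odot> x))"
    by (simp add: Compl_eq_Diff_UNIV sum_diff)
  then show ?thesis
    using sum_chi_dot_N[of a] by (simp add: T_eq dot_commute[of a])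
qed

text \<open>The sum of all elements of the full graph vanishes, so the elements of \<open>A\<close> sum to the pair of \<open>\<sigma>1\<close>
and \<open>\<sigma>2\<close>.\<close>

lemma T_mod_4: "4 dvd T a c - int (card A) + 1 - chi (a \<odot> \<sigma>1 + c \<odot> \<sigma>2)"
proof -
  have "(\<Sum>x\<in>- S. x) + \<sigma>1 = 0" "(\<Sum>x\<in>- S. G x) + \<sigma>2 = 0"
    using sum.subset_diff[of S UNIV "\<lambda>x. x"] sum.subset_diff[of S UNIV G] sum_vec_UNIV[where 'n='n] dim sum_G
    by (simp_all add: \<sigma>1_def \<sigma>2_def Compl_eq_Diff_UNIV)
  then have "(\<Sum>x\<in>- S. x) = \<sigma>1" "(\<Sum>x\<in>- S. G x) = \<sigma>2"
    by (simp_all only: vec_add_eq_0_iff)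
  then have "(\<Sum>x\<in>- S. a \<odot> x + c \<odot> G x) = a \<odot> \<sigma>1 + c \<odot> \<sigma>2"
    by (simp add: sum.distrib flip: dot_sum_right)
  moreover have "card (- S) = card A"
    unfolding A_def by (intro card_image[symmetric]) (auto simp: inj_on_def)
  ultimately show ?thesis
    using sum_chi_mod_4[of "- S" "\<lambda>x. a \<odot> x + c \<odot> G x"] by (simp add: T_eq)
qed

definition e :: "bit ^ 'n" where "e = (SOME e. b \<odot> e = 1)"

lemma b_dot_e: "b \<odot> e = 1"
proof -
  obtain x where "b \<odot> x = 1" using b_nonzero by (rule exists_dot_1)
  then show ?thesis unfolding e_def by (rule someI)
qed

text \<open>For \<open>q\<close> orthogonal to \<open>b\<close>, the vectors orthogonal to \<open>q\<close> fall into pairs \<open>c\<close>, \<open>c + b\<close> on which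
\<open>T a\<close> takes equal values. Parity arguments need one representative of each pair, and orthogonality to \<open>e\<close>
selects it.\<close>

definition K :: "bit ^ 'n \<Rightarrow> (bit ^ 'n) set" where
  "K q = {c. c \<odot> e = 0 \<and> c \<odot> q = 0}"

lemma zero_in_K: "0 \<in> K q" and b_notin_K: "b \<notin> K q"
  by (simp_all add: K_def b_dot_e)

lemma N_eq: "N = 4 * 2 ^ (CARD('n) - 2)"
proof -
  have "2 \<le> CARD('n)" using dim by simp
  then obtain k where "CARD('n) = 2 + k" unfolding le_iff_add by blast
  then show ?thesis by (simp add: N_def power_add)
qed

lemma dvd_sum_chi_K: "2 ^ (CARD('n) - 2) dvd (\<Sum>c\<in>K q. chi (c \<odot> y))"
proof -
  have "4 * (\<Sum>c\<in>K q. chi (c \<odot> y)) = (\<Sum>c\<in>UNIV. if c \<in> K q then 4 * chi (c \<odot> y) else 0)"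
    by (simp add: sum.If_cases sum_distrib_left)
  \<comment> \<open>The indicator function of \<open>K q\<close> is expanded into characters.\<close>
  also have "\<dots> = (\<Sum>c\<in>UNIV. chi (c \<odot> y) + chi (c \<odot> (y + e)) + chi (c \<odot> (y + q)) + chi (c \<odot> (y + e + q)))"
    by (intro sum.cong refl) (auto simp: K_def dot_add_right chi_add chi_def)
  also have "\<dots> = N * (of_bool (y = 0) + of_bool (y + e = 0) + of_bool (y + q = 0) + of_bool (y + e + q = 0))"
    by (simp add: sum.distrib sum_chi_dot_N distrib_left of_bool_def)
  finally show ?thesis
    unfolding N_eq by simp
qed

lemma dvd_sum_T_K: "2 ^ (CARD('n) - 2) dvd (\<Sum>c\<in>K q. T a c)"
proof -
  have "(\<Sum>c\<in>K q. T a c) = (\<Sum>x\<in>- S. \<Sum>c\<in>K q. chi (a \<odot> x + c \<odot> G x))"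
    unfolding T_eq by (rule sum.swap)
  also have "\<dots> = (\<Sum>x\<in>- S. chi (a \<odot> x) * (\<Sum>c\<in>K q. chi (c \<odot> G x)))"
    by (simp add: chi_add sum_distrib_left)
  finally show ?thesis
    by (simp add: dvd_sum dvd_mult dvd_sum_chi_K)
qed

lemma odd_card_K_minus_0: "odd (card (K q - {0}))"
proof -
  have "(2 :: int) dvd 2 ^ (CARD('n) - 2)"
    using dim by (intro dvd_power) auto
  moreover have "(2 :: int) ^ (CARD('n) - 2) dvd int (card (K q))"
    using dvd_sum_chi_K[where y = 0 and q = q] by simp
  ultimately have "(2 :: int) dvd int (card (K q))"
    by (rule dvd_trans)
  moreover have "card (K q) = Suc (card (K q - {0}))"
    using card_Suc_Diff1[OF finite zero_in_K] by simp
  ultimately show ?thesis by presburger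
qed

text \<open>The sum over \<open>K q\<close> is a multiple of \<open>N / 4\<close>. It is also an odd multiple of the square root \<open>s\<close> of
\<open>N\<close>, whereas \<open>2 * s\<close> divides \<open>N / 4\<close> in even dimension at least \<open>6\<close>.\<close>

lemma nyberg:
  assumes "even CARD('n)" and T0: "T a 0 = 0"
    and T: "\<And>c. c \<in> K q \<Longrightarrow> c \<noteq> 0 \<Longrightarrow> (T a c)\<^sup>2 = N"
  shows False
proof -
  obtain m where m: "CARD('n) = 2 * m" using assms(1) by (elim evenE)
  with dim have "m \<ge> 3" by simp
  define s :: int where "s = 2 ^ m"
  define \<epsilon> where "\<epsilon> c = (if T a c = s then 1 else - 1 :: int)" for c
  have s: "s > 0" "N = s\<^sup>2"
    by (simp_all add: s_def N_def m power_mult power2_eq_square flip: power_mult_distrib)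
  have \<epsilon>: "T a c = s * \<epsilon> c \<and> odd (\<epsilon> c)" if "c \<in> K q - {0}" for c
  proof -
    have "T a c = s \<or> T a c = - s"
      using T[of c] that s(2) by (simp add: power2_eq_iff)
    then show ?thesis using s(1) by (auto simp: \<epsilon>_def)
  qed
  have "odd (\<Sum>c\<in>K q - {0}. \<epsilon> c)"
  proof -
    have "{c \<in> K q - {0}. odd (\<epsilon> c)} = K q - {0}" using \<epsilon> by auto
    then show ?thesis using odd_card_K_minus_0[of q] by (simp add: even_sum_iff)
  qed
  moreover have "(\<Sum>c\<in>K q. T a c) = s * (\<Sum>c\<in>K q - {0}. \<epsilon> c)"
    using \<epsilon> by (subst sum.remove[OF finite zero_in_K]) (simp add: T0 sum_distrib_left)
  moreover have "2 ^ (m + 1) dvd (2 :: int) ^ (CARD('n) - 2)"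
    using m \<open>m \<ge> 3\<close> by (intro le_imp_power_dvd) auto
  then have "2 ^ (m + 1) dvd (\<Sum>c\<in>K q. T a c)"
    using dvd_sum_T_K by (rule dvd_trans)
  then have "s * 2 dvd (\<Sum>c\<in>K q. T a c)"
    by (simp add: s_def mult.commute)
  ultimately show False
    using s(1) by simp
qed

lemma N_dvd: "32 dvd N"
proof -
  have "(2 :: int) ^ 5 dvd 2 ^ CARD('n)"
    using dim by (intro le_imp_power_dvd)
  then show ?thesis by (simp add: N_def)
qed

lemma N_ge: "N \<ge> 32"
  using N_dvd by (intro zdvd_imp_le) (simp_all add: N_def)

lemma sum_const_UNIV: "(\<Sum>a\<in>(UNIV :: (bit ^ 'n) set). x) = N * x"
  by (simp add: N_def)

lemma sum_split_at_b:
  "(\<Sum>u\<in>UNIV. f u) = (\<Sum>a\<in>UNIV. \<Sum>c\<in>- {0, b}. f (a, c)) + (\<Sum>a\<in>UNIV. f (a, 0)) + (\<Sum>a\<in>UNIV. f (a, b))"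
  for f :: "(bit ^ 'n) \<times> (bit ^ 'n) \<Rightarrow> int"
proof -
  have "(\<Sum>c\<in>UNIV. f (a, c)) = (\<Sum>c\<in>- {0, b}. f (a, c)) + f (a, 0) + f (a, b)" for a
    using sum.subset_diff[of "{0, b}" UNIV "\<lambda>c. f (a, c)"] b_nonzero
    by (simp add: Compl_eq_Diff_UNIV)
  then show ?thesis
    by (simp add: sum_pairs sum.distrib)
qed

text \<open>In the columns \<open>c = 0\<close> and \<open>c = b\<close> the values of \<open>T\<close> are at most \<open>card S\<close> in absolute value except
at \<open>a = 0\<close>, where the value is nearly \<open>N\<close>. None of them is close to the square root of \<open>N\<close>, so these columns
are taken out of the moments.\<close>

lemma quartic_sum_off_b:
  assumes "(t1, t2) \<noteq> 0" "b \<odot> t2 = 0"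
  defines "v \<equiv> int (card A)"
  shows "(\<Sum>a\<in>UNIV. \<Sum>c\<in>- {0, b}. p * T a c ^ 4 + q * (T a c)\<^sup>2 + r
            + (p' * T a c ^ 4 + q' * (T a c)\<^sup>2 + r') * chi (a \<odot> t1 + c \<odot> t2))
     = N\<^sup>2 * (p * (3 * v\<^sup>2 - 2 * v) + q * v + r
          + p' * (\<Sum>z\<in>UNIV. rep A z * rep A (z + (t1, t2))) + q' * rep A (t1, t2))
       - 2 * (\<Sum>a\<in>UNIV. p * T a 0 ^ 4 + q * (T a 0)\<^sup>2 + r
            + (p' * T a 0 ^ 4 + q' * (T a 0)\<^sup>2 + r') * chi (a \<odot> t1))"
proof -
  define f where "f u = p * char_sum A u ^ 4 + q * (char_sum A u)\<^sup>2 + r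
            + (p' * char_sum A u ^ 4 + q' * (char_sum A u)\<^sup>2 + r') * chi (u \<diamondop> (t1, t2))" for u
  have f: "f (a, c) = p * T a c ^ 4 + q * (T a c)\<^sup>2 + r
            + (p' * T a c ^ 4 + q' * (T a c)\<^sup>2 + r') * chi (a \<odot> t1 + c \<odot> t2)" for a c
    by (simp add: f_def T_def pair_dot_def)
  have "f (a, b) = f (a, 0)" for a
    unfolding f by (simp add: T_b assms(2))
  then have "(\<Sum>u\<in>UNIV. f u) = (\<Sum>a\<in>UNIV. \<Sum>c\<in>- {0, b}. f (a, c)) + 2 * (\<Sum>a\<in>UNIV. f (a, 0))"
    by (simp add: sum_split_at_b)
  moreover have "(\<Sum>u\<in>UNIV. f u) = N\<^sup>2 * (p * (3 * v\<^sup>2 - 2 * v) + q * v + r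
          + p' * (\<Sum>z\<in>UNIV. rep A z * rep A (z + (t1, t2))) + q' * rep A (t1, t2))"
    unfolding f_def using sidon_quartic_sum[OF sidon_A assms(1)] by (simp add: v_def N_def)
  ultimately show ?thesis
    unfolding f by simp
qed

lemma sum_at_zero:
  "(\<Sum>a\<in>UNIV. if a = (0 :: bit ^ 'n) then x else f a) = (\<Sum>a\<in>UNIV. f a) - f 0 + (x :: int)"
  using sum.remove[of UNIV "0 :: bit ^ 'n" f] sum.remove[of UNIV "0 :: bit ^ 'n" "\<lambda>a. if a = 0 then x else f a"]
  by simp

lemma sum_affine_chi:
  assumes "d \<noteq> (0 :: bit ^ 'n)"
  shows "(\<Sum>a\<in>UNIV. x + y * chi (a \<odot> d)) = N * x"
  unfolding sum.distrib sum_distrib_left[symmetric] sum_const_UNIV sum_chi_dot_N using assms by simp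

section \<open>Components at distance zero or two from an affine function\<close>

text \<open>If \<open>b \<odot> G\<close> vanishes, then \<open>(T a c)\<^sup>2 - N\<close> has mean square zero off the columns \<open>0\<close> and \<open>b\<close>: the
function \<open>G\<close> is vectorial bent into a hyperplane. This makes \<open>N\<close> a square, and then Nyberg's argument
applies.\<close>

lemma S_nonempty: "S \<noteq> {}"
proof
  assume S: "S = {}"
  have v: "int (card A) = N" unfolding card_A by (simp add: S)
  have T0: "T a 0 = (if a = 0 then N else 0)" for a unfolding T_0 by (simp add: S)
  have "axis undefined 1 \<noteq> (0 :: bit ^ 'n)" by (simp add: axis_eq_0_iff)
  then obtain d :: "bit ^ 'n" where d: "d \<noteq> 0" by blast
  have T0_poly: "1 * T a 0 ^ 4 + (- 2 * N) * (T a 0)\<^sup>2 + N\<^sup>2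
        + (0 * T a 0 ^ 4 + 0 * (T a 0)\<^sup>2 + 0) * chi (a \<odot> d) = (if a = 0 then (N\<^sup>2 - N)\<^sup>2 else N\<^sup>2)" for a
    by (simp add: T0 power2_eq_square power4_eq_xxxx algebra_simps)
  have "(\<Sum>a\<in>UNIV. \<Sum>c\<in>- {0, b}. ((T a c)\<^sup>2 - N)\<^sup>2)
      = (\<Sum>a\<in>UNIV. \<Sum>c\<in>- {0, b}. 1 * T a c ^ 4 + (- 2 * N) * (T a c)\<^sup>2 + N\<^sup>2
            + (0 * T a c ^ 4 + 0 * (T a c)\<^sup>2 + 0) * chi (a \<odot> d + c \<odot> 0))"
    by (intro sum.cong refl) (simp add: power4_eq_xxxx power2_eq_square algebra_simps)
  also have "\<dots> = N\<^sup>2 * (2 * N\<^sup>2 - 2 * N) - 2 * (\<Sum>a\<in>UNIV. if a = (0 :: bit ^ 'n) then (N\<^sup>2 - N)\<^sup>2 else N\<^sup>2)"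
    using d by (subst quartic_sum_off_b)
      (simp_all only: T0_poly, simp_all add: zero_prod_def v power2_eq_square power4_eq_xxxx algebra_simps)
  also have "\<dots> = 0"
    unfolding sum_at_zero sum_const_UNIV by (simp add: power2_eq_square algebra_simps)
  finally have "\<forall>a. \<forall>c\<in>- {0, b}. ((T a c)\<^sup>2 - N)\<^sup>2 = 0"
    by (simp add: sum_nonneg_eq_0_iff sum_nonneg)
  then have T: "(T a c)\<^sup>2 = N" if "c \<noteq> 0" "c \<noteq> b" for a c
    using that by simp
  have "K 0 - {0} \<noteq> {}" using odd_card_K_minus_0[of 0] by (metis card.empty even_zero)
  then obtain c where "c \<in> K 0" "c \<noteq> 0" by blast
  then have "(T d c)\<^sup>2 = N" using T b_notin_K by metis
  then have "even CARD('n)"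
    using even_exponent_of_square by (metis N_def)
  moreover have "T d 0 = 0" using d T0 by simp
  ultimately show False
    using nyberg[of d 0] T b_notin_K by metis
qed

text \<open>The values of \<open>T\<close> are \<open>2\<close> modulo \<open>4\<close> on one half of the rows and \<open>0\<close> modulo \<open>4\<close> on the other half.
For a nonnegative quartic on each half, with the same leading coefficient, the sum depends only on the full
fourth moment. Let \<open>y\<close> and \<open>z\<close> be consecutive multiples of \<open>4\<close> around the square root of \<open>N\<close>. The quartic with
roots \<open>w - 2\<close> and \<open>w + 2\<close> on the first half and the one with roots \<open>y\<close> and \<open>z\<close> on the second half lead to
\<open>0 \<le> (N - w\<^sup>2)\<^sup>2 + (N - y\<^sup>2) * (N - z\<^sup>2)\<close>. The choices \<open>w = y\<close> and \<open>w = z\<close> together force \<open>2 * N = y\<^sup>2 + z\<^sup>2\<close>,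
which is impossible for a power of two. If \<open>N = w\<^sup>2\<close> for a multiple \<open>w\<close> of \<open>4\<close>, then \<open>y = z = w\<close> gives the sum
zero instead, and Nyberg's argument applies to a row of the second half.\<close>

lemma S_not_pair:
  assumes S: "S = {s, t}" "s \<noteq> t" and G: "G s = G t"
  shows False
proof -
  have \<sigma>1: "\<sigma>1 = s + t" "\<sigma>1 \<noteq> 0" unfolding \<sigma>1_def using S by (simp_all add: vec_add_eq_0_iff)
  have \<sigma>2: "\<sigma>2 = 0" unfolding \<sigma>2_def using S G by simp
  have v: "int (card A) = N - 2" unfolding card_A using S by simp
  have T0: "T a 0 = (if a = 0 then N else 0) - chi (a \<odot> s) * (1 + chi (a \<odot> \<sigma>1))" for a
    unfolding T_0 \<sigma>1(1) using S by (simp add: dot_add_right chi_add distrib_left flip: mult.assoc)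
  have rep: "rep A (\<sigma>1, 0) = 0"
  proof -
    have "s + \<sigma>1 = t" unfolding \<sigma>1(1) by simp
    moreover have "t + \<sigma>1 = s" unfolding \<sigma>1(1) add.commute[of s t] by simp
    ultimately have "{s, t} \<subseteq> {x. G (x + \<sigma>1) + G x = 0}"
      using G by simp
    moreover have "card {x. G (x + \<sigma>1) + G x = 0} \<le> card {s, t}"
      using card_derivative_fibre[OF \<sigma>1(2), of 0] S(2) by simp
    ultimately have "{s, t} = {x. G (x + \<sigma>1) + G x = 0}"
      by (intro card_seteq) auto
    then have "{x. x \<notin> S \<and> x + \<sigma>1 \<notin> S \<and> G (x + \<sigma>1) + G x = 0} = {}"
      using S(1) by auto
    then show ?thesis unfolding rep_A by (simp only: card.empty)
  qed
  define P0 where "P0 w x = (x\<^sup>2 - (w - 2)\<^sup>2) * (x\<^sup>2 - (w + 2)\<^sup>2)" for w x :: int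
  define P1 where "P1 y z x = (x\<^sup>2 - y\<^sup>2) * (x\<^sup>2 - z\<^sup>2)" for y z x :: int
  define F where "F w y z a c = (1 + chi (a \<odot> \<sigma>1)) * P0 w (T a c) + (1 - chi (a \<odot> \<sigma>1)) * P1 y z (T a c)"
    for w y z a c
  have total: "(\<Sum>a\<in>UNIV. \<Sum>c\<in>- {0, b}. F w y z a c)
      = N * (N - 2) * ((N - w\<^sup>2)\<^sup>2 + (N - y\<^sup>2) * (N - z\<^sup>2))" for w y z
  proof -
    define q r q' r' where qr: "q = - (2 * w\<^sup>2 + 8 + y\<^sup>2 + z\<^sup>2)" "r = (w\<^sup>2 - 4)\<^sup>2 + y\<^sup>2 * z\<^sup>2"
      "q' = y\<^sup>2 + z\<^sup>2 - 2 * w\<^sup>2 - 8" "r' = (w\<^sup>2 - 4)\<^sup>2 - y\<^sup>2 * z\<^sup>2"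
    have F: "F w y z a c = 2 * T a c ^ 4 + q * (T a c)\<^sup>2 + r + (0 * T a c ^ 4 + q' * (T a c)\<^sup>2 + r') * chi (a \<odot> \<sigma>1 + c \<odot> 0)" for a c
      by (simp add: F_def P0_def P1_def qr power2_eq_square power4_eq_xxxx algebra_simps)
    have "2 * T a 0 ^ 4 + q * (T a 0)\<^sup>2 + r + (0 * T a 0 ^ 4 + q' * (T a 0)\<^sup>2 + r') * chi (a \<odot> \<sigma>1)
        = (if a = 0 then 2 * (N - 2) ^ 4 + q * (N - 2)\<^sup>2 + r + q' * (N - 2)\<^sup>2 + r'
           else (16 + 2 * q + r + 2 * q') + (16 + 2 * q + 2 * q' + r') * chi (a \<odot> \<sigma>1))" for a
      unfolding T0 by (simp add: chi_def[of "a \<odot> \<sigma>1"] chi_def[of "a \<odot> s"])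
    then have T0_sum: "(\<Sum>a\<in>UNIV. 2 * T a 0 ^ 4 + q * (T a 0)\<^sup>2 + r + (0 * T a 0 ^ 4 + q' * (T a 0)\<^sup>2 + r') * chi (a \<odot> \<sigma>1))
        = N * (16 + 2 * q + r + 2 * q') - (32 + 4 * q + r + 4 * q' + r')
          + (2 * (N - 2) ^ 4 + q * (N - 2)\<^sup>2 + r + q' * (N - 2)\<^sup>2 + r')"
      by (simp only: sum_at_zero sum_affine_chi[OF \<sigma>1(2)]) simp
    have "(\<Sum>a\<in>UNIV. \<Sum>c\<in>- {0, b}. F w y z a c)
      = N\<^sup>2 * (2 * (3 * (N - 2)\<^sup>2 - 2 * (N - 2)) + q * (N - 2) + r)
       - 2 * (N * (16 + 2 * q + r + 2 * q') - (32 + 4 * q + r + 4 * q' + r')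
          + (2 * (N - 2) ^ 4 + q * (N - 2)\<^sup>2 + r + q' * (N - 2)\<^sup>2 + r'))"
      unfolding F using \<sigma>1(2) by (subst quartic_sum_off_b) (simp_all only: T0_sum, simp_all add: zero_prod_def v rep)
    also have "\<dots> = N * (N - 2) * ((N - w\<^sup>2)\<^sup>2 + (N - y\<^sup>2) * (N - z\<^sup>2))"
      unfolding qr by algebra
    finally show ?thesis .
  qed
  have T_mod: "4 dvd T a c - 2 \<and> a \<odot> \<sigma>1 = 0 \<or> 4 dvd T a c \<and> a \<odot> \<sigma>1 = 1" for a c
    using T_mod_4[of a c] N_dvd unfolding \<sigma>2 v by (cases "a \<odot> \<sigma>1") (simp_all, presburger+)
  have F_nonneg: "0 \<le> F w y z a c"
    if "4 dvd w" "4 \<le> w" "4 dvd y" "0 \<le> y" "y \<le> z" "z \<le> y + 4" for w y z a c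
  proof (cases "a \<odot> \<sigma>1 = 0")
    case True
    then have "4 dvd T a c - 2" using T_mod[of a c] by simp
    then have "4 dvd T a c - (w - 2)" using that(1) by presburger
    then have "0 \<le> P0 w (T a c)"
      unfolding P0_def using that(1,2) by (intro gap_poly_nonneg[where d = 4]) (assumption | presburger)+
    then show ?thesis using True by (simp add: F_def)
  next
    case False
    then have "4 dvd T a c" using T_mod[of a c] by simp
    then have "4 dvd T a c - y" using that by simp
    moreover have "4 dvd 2 * y" using that(3) by presburger
    ultimately have "0 \<le> P1 y z (T a c)"
      unfolding P1_def using that by (intro gap_poly_nonneg[where d = 4]) auto
    then show ?thesis using False by (simp add: F_def)
  qed
  \<comment> \<open>The multiples of \<open>4\<close> around the square root of \<open>N\<close> come from the integers around the
    square root of \<open>N / 16\<close>.\<close>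
  obtain k where "CARD('n) = 5 + k"
    using dim unfolding le_iff_add by blast
  then have k: "CARD('n) = 4 + (k + 1)" by simp
  obtain j0 :: nat where j0: "j0\<^sup>2 \<le> 2 ^ (k + 1)" "2 ^ (k + 1) < (j0 + 1)\<^sup>2"
    using nat_sqrt_bracket by blast
  define j where "j = int j0"
  have N16: "N = 16 * 2 ^ (k + 1)"
    unfolding N_def k power_add[of _ 4] by simp
  have "int (j0\<^sup>2) \<le> int (2 ^ (k + 1))" "int (2 ^ (k + 1)) < int ((j0 + 1)\<^sup>2)"
    using j0 by (simp_all only: of_nat_le_iff of_nat_less_iff)
  then have j: "16 * j\<^sup>2 \<le> N" "N < 16 * (j + 1)\<^sup>2"
    unfolding N16 j_def by (simp_all add: add.commute)
  have "j \<noteq> 0" using j(2) N_ge by auto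
  then have j1: "j \<ge> 1" unfolding j_def by simp
  show False
  proof (cases "16 * j\<^sup>2 = N")
    case True
    then have N: "(4 * j)\<^sup>2 = N" by (simp add: power_mult_distrib)
    have "(\<Sum>a\<in>UNIV. \<Sum>c\<in>- {0, b}. F (4 * j) (4 * j) (4 * j) a c) = 0"
      unfolding total N by simp
    moreover have "0 \<le> F (4 * j) (4 * j) (4 * j) a c" for a c
      using j1 by (intro F_nonneg) auto
    ultimately have F0: "\<forall>a. \<forall>c\<in>- {0, b}. F (4 * j) (4 * j) (4 * j) a c = 0"
      by (simp add: sum_nonneg_eq_0_iff sum_nonneg)
    obtain a where a: "a \<odot> \<sigma>1 = 1"
      using exists_dot_1[OF \<sigma>1(2)] by (metis dot_commute)
    have "(T a c)\<^sup>2 = N" if "c \<in> K 0" "c \<noteq> 0" for c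
    proof -
      have "c \<in> - {0, b}" using that b_notin_K by auto
      with F0 have "F (4 * j) (4 * j) (4 * j) a c = 0" by blast
      then show ?thesis using a N by (simp add: F_def P1_def)
    qed
    moreover have "T a 0 = 0"
      using a by (auto simp: T0)
    moreover have "even CARD('n)"
      using even_exponent_of_square N by (metis N_def)
    ultimately show False using nyberg by blast
  next
    case False
    with j have less: "(4 * j)\<^sup>2 < N" "N < (4 * j + 4)\<^sup>2"
      by (simp_all add: power2_eq_square algebra_simps)
    have nonneg: "0 \<le> (N - w\<^sup>2)\<^sup>2 + (N - (4 * j)\<^sup>2) * (N - (4 * j + 4)\<^sup>2)" if "4 dvd w" "4 \<le> w" for w
    proof -
      have "0 \<le> N * (N - 2) * ((N - w\<^sup>2)\<^sup>2 + (N - (4 * j)\<^sup>2) * (N - (4 * j + 4)\<^sup>2))"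
        unfolding total[symmetric] using j1 that by (intro sum_nonneg F_nonneg) auto
      moreover have "0 < N * (N - 2)" using N_ge by simp
      ultimately show ?thesis by (simp add: zero_le_mult_iff)
    qed
    define y z where "y = (4 * j)\<^sup>2" and "z = (4 * j + 4)\<^sup>2"
    have "0 \<le> (N - y)\<^sup>2 + (N - y) * (N - z)" "0 \<le> (N - z)\<^sup>2 + (N - y) * (N - z)"
      unfolding y_def z_def using nonneg[of "4 * j"] nonneg[of "4 * j + 4"] j1 by simp_all
    then have "0 \<le> (N - y) * (2 * N - y - z)" "0 \<le> (z - N) * (- (2 * N - y - z))"
      by (simp_all add: power2_eq_square algebra_simps)
    moreover have "y < N" "N < z" using less by (simp_all only: y_def z_def)
    ultimately have "2 * N = y + z"
      by (simp add: zero_le_mult_iff)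
    then have "2 ^ (k + 2) = 2 * (j\<^sup>2 + j) + 1"
      unfolding N16 y_def z_def by (simp add: power2_eq_square algebra_simps)
    then have "even (2 * (j\<^sup>2 + j) + 1)" by (metis even_power even_numeral zero_less_Suc add_2_eq_Suc')
    then show False by simp
  qed
qed

section \<open>Distance four: support points with nonzero sum\<close>

lemma rep_chi_b: "rep A z * chi (z \<diamondop> (0, b)) = rep A z"
proof (cases "rep A z = 0")
  case False
  obtain p q where z: "z = (p, q)" by (cases z)
  have "{x. x \<notin> S \<and> x + p \<notin> S \<and> G (x + p) + G x = q} \<noteq> {}"
    using False unfolding z rep_A by (metis card.empty of_nat_0)
  then obtain x where "x \<notin> S" "x + p \<notin> S" "G (x + p) + G x = q" by blast
  then have "b \<odot> q = 0" using component by (auto simp: dot_add_right)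
  then show ?thesis by (simp add: z pair_dot_def dot_commute)
qed simp

text \<open>All sums of two elements of \<open>A\<close> lie in the hyperplane orthogonal to \<open>(0, b)\<close>, and \<open>A\<close> is so large
that most elements of this hyperplane have two representations. The bound comes from
\<open>0 \<le> (2 - rep A z) * (2 - rep A (z + \<tau>))\<close>, which holds for all \<open>z\<close> other than \<open>0\<close> and \<open>\<tau>\<close>; the factor
\<open>1 + chi (z \<diamondop> (0, b))\<close> restricts the sum to the hyperplane.\<close>

lemma fourth_correlation_lower_bound:
  assumes "\<tau> \<noteq> 0" "b \<odot> snd \<tau> = 0" "card A \<ge> 2"
  defines "v \<equiv> int (card A)"
  shows "4 * v\<^sup>2 - 2 * N\<^sup>2 + 2 * (2 - v) * (2 - rep A \<tau>) \<le> (\<Sum>z\<in>UNIV. rep A z * rep A (z + \<tau>))"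
proof -
  let ?\<chi> = "\<lambda>z. chi (z \<diamondop> (0, b))"
  define f where "f z = (1 + ?\<chi> z) * ((2 - rep A z) * (2 - rep A (z + \<tau>)))" for z
  have \<tau>: "\<tau> \<diamondop> (0, b) = 0"
    using assms(2) by (simp add: pair_dot_def dot_commute)
  have rep_shift: "rep A (z + \<tau>) * ?\<chi> z = rep A (z + \<tau>)" for z
    using rep_chi_b[of "z + \<tau>"] by (simp add: pair_dot_add_left \<tau>)
  have "f z = 4 * (1 + ?\<chi> z) - 4 * rep A z - 4 * rep A (z + \<tau>) + 2 * (rep A z * rep A (z + \<tau>))" for z
    using rep_chi_b[of z] rep_shift[of z] chi_cases[of "z \<diamondop> (0, b)"]
    unfolding f_def by (elim disjE) (simp_all add: algebra_simps)
  then have "(\<Sum>z\<in>UNIV. f z) = 4 * ((\<Sum>z\<in>(UNIV :: ((bit ^ 'n) \<times> (bit ^ 'n)) set). 1) + (\<Sum>z\<in>UNIV. ?\<chi> z))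
      - 4 * (\<Sum>z\<in>UNIV. rep A z) - 4 * (\<Sum>z\<in>UNIV. rep A (z + \<tau>)) + 2 * (\<Sum>z\<in>UNIV. rep A z * rep A (z + \<tau>))"
    by (simp only: sum.distrib sum_subtractf sum_distrib_left[symmetric])
  also have "(\<Sum>z\<in>UNIV. rep A (z + \<tau>)) = (\<Sum>z\<in>UNIV. rep A z)"
    by (rule sum_UNIV_shift)
  also have "(\<Sum>z\<in>UNIV. ?\<chi> z) = 0"
    using b_nonzero by (simp add: sum_chi_pair_dot zero_prod_def)
  also have "(\<Sum>z\<in>(UNIV :: ((bit ^ 'n) \<times> (bit ^ 'n)) set). 1) = N\<^sup>2"
    using sum_chi_pair_dot[of "0 :: (bit ^ 'n) \<times> (bit ^ 'n)"] by (simp add: pair_dot_def N_def del: sum_constant)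
  finally have sum_f: "(\<Sum>z\<in>UNIV. f z) = 4 * N\<^sup>2 - 8 * v\<^sup>2 + 2 * (\<Sum>z\<in>UNIV. rep A z * rep A (z + \<tau>))"
    by (simp add: sum_rep v_def)
  have "(\<Sum>z\<in>{0, \<tau>}. f z) \<le> (\<Sum>z\<in>UNIV. f z)"
  proof (rule sum_mono2)
    fix z assume "z \<in> UNIV - {0, \<tau>}"
    then have "z \<noteq> 0" "z + \<tau> \<noteq> 0" using pair_add_eq_0_iff[of z \<tau>] by auto
    then have "rep A z \<le> 2" "rep A (z + \<tau>) \<le> 2" using sidon_A unfolding sidon_def by blast+
    moreover have "0 \<le> 1 + ?\<chi> z" using chi_cases[of "z \<diamondop> (0, b)"] by auto
    ultimately show "0 \<le> f z" unfolding f_def by simp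
  qed auto
  moreover have "(\<Sum>z\<in>{0, \<tau>}. f z) = 4 * ((2 - v) * (2 - rep A \<tau>))"
  proof -
    have "f 0 = 2 * ((2 - v) * (2 - rep A \<tau>))" "f \<tau> = 2 * ((2 - rep A \<tau>) * (2 - v))"
      unfolding f_def using \<tau> by (simp_all add: v_def pair_dot_def)
    then show ?thesis using assms(1) by (simp add: mult.commute)
  qed
  ultimately show ?thesis using sum_f unfolding mult.assoc[of 2] by linarith
qed

text \<open>For a general \<open>K q\<close> the exponent is smaller by one, because of the second linear
condition.\<close>

lemma dvd_sum_chi_K_0: "2 ^ (CARD('n) - 1) dvd (\<Sum>c\<in>K 0. chi (c \<odot> y))"
proof -
  have "2 * (\<Sum>c\<in>K 0. chi (c \<odot> y)) = (\<Sum>c\<in>UNIV. if c \<in> K 0 then 2 * chi (c \<odot> y) else 0)"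
    by (simp add: sum.If_cases sum_distrib_left)
  also have "\<dots> = (\<Sum>c\<in>UNIV. chi (c \<odot> y) + chi (c \<odot> (y + e)))"
    by (intro sum.cong refl) (auto simp: K_def dot_add_right chi_add chi_def)
  also have "\<dots> = N * (of_bool (y = 0) + of_bool (y + e = 0))"
    by (simp add: sum.distrib sum_chi_dot_N distrib_left of_bool_def)
  also have "N = 2 * 2 ^ (CARD('n) - 1)"
    unfolding N_def by (simp flip: power_Suc)
  finally show ?thesis by simp
qed

text \<open>On the rows with \<open>a \<odot> \<sigma>1 = 1\<close> all values of \<open>T\<close> are \<open>2\<close> modulo \<open>4\<close>. There the quartic with roots
\<open>s - 2\<close> and \<open>s + 2\<close> is nonnegative with a sum of at most \<open>44 * N\<^sup>2\<close>. A value other than these roots would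
contribute at least \<open>48 * N\<close>, and occur in two columns \<open>c\<close> and \<open>c + b\<close>, so at least one of the \<open>N / 2\<close> rows
has none.\<close>

lemma exists_row_near_root:
  assumes S: "card S = 4" and \<sigma>: "\<sigma>1 \<noteq> 0" "\<sigma>2 = 0"
    and s: "N = s\<^sup>2" "8 dvd s" "8 \<le> s"
  obtains a where "a \<odot> \<sigma>1 = 1" "\<And>c. c \<in> K 0 \<Longrightarrow> c \<noteq> 0 \<Longrightarrow> (T a c)\<^sup>2 = (s - 2)\<^sup>2 \<or> (T a c)\<^sup>2 = (s + 2)\<^sup>2"
    "(T a 0)\<^sup>2 = 4" "\<And>c. 4 dvd T a c - 2"
proof -
  have v: "int (card A) = N - 4" unfolding card_A using S by simp
  have T_mod: "4 dvd T a c - 2" if "a \<odot> \<sigma>1 = 1" for a c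
  proof -
    have "4 dvd T a c - (N - 4) + 1 - (- 1)"
      using T_mod_4[of a c] that unfolding \<sigma> v by simp
    then show ?thesis using N_dvd by presburger
  qed
  have T0: "(T a 0)\<^sup>2 = 4" if "a \<odot> \<sigma>1 = 1" for a
  proof -
    have "a \<noteq> 0" using that by auto
    then have "\<bar>T a 0\<bar> = \<bar>\<Sum>x\<in>S. chi (a \<odot> x)\<bar>" by (simp add: T_0)
    also have "\<dots> \<le> (\<Sum>x\<in>S. \<bar>chi (a \<odot> x)\<bar>)" by (rule sum_abs)
    also have "\<dots> = 4" using S by simp
    finally have "\<bar>T a 0\<bar> \<le> 4" .
    with T_mod[OF that, of 0] have "T a 0 = 2 \<or> T a 0 = - 2" by presburger
    then show ?thesis by auto
  qed
  define P where "P x = (x\<^sup>2 - (s - 2)\<^sup>2) * (x\<^sup>2 - (s + 2)\<^sup>2)" for x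
  have P: "P x = x ^ 4 - (2 * N + 8) * x\<^sup>2 + (N - 4)\<^sup>2" for x
    unfolding P_def s(1) by (simp add: power2_eq_square power4_eq_xxxx algebra_simps)
  define F where "F a c = (1 - chi (a \<odot> \<sigma>1)) * P (T a c)" for a c
  have F_poly: "F a c = 1 * T a c ^ 4 + (- (2 * N + 8)) * (T a c)\<^sup>2 + (N - 4)\<^sup>2
      + ((- 1) * T a c ^ 4 + (2 * N + 8) * (T a c)\<^sup>2 + (- (N - 4)\<^sup>2)) * chi (a \<odot> \<sigma>1 + c \<odot> 0)" for a c
    unfolding F_def P by (simp add: algebra_simps)
  \<comment> \<open>The polynomial \<open>P\<close> takes the value \<open>N\<^sup>2 - 16 * N\<close> at \<open>2\<close> and \<open>- 2\<close>.\<close>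
  have F_0: "F a 0 = (N\<^sup>2 - 16 * N) + (- (N\<^sup>2 - 16 * N)) * chi (a \<odot> \<sigma>1)" for a
  proof (cases "a \<odot> \<sigma>1 = 0")
    case False
    then have "(T a 0)\<^sup>2 = 4" using T0 by simp
    moreover have "T a 0 ^ 4 = ((T a 0)\<^sup>2)\<^sup>2" by simp
    ultimately show ?thesis using False unfolding F_def P by (simp add: power2_eq_square algebra_simps)
  qed (simp add: F_def)
  define Q where "Q = (\<Sum>z\<in>UNIV. rep A z * rep A (z + (\<sigma>1, 0)))"
  define \<alpha> where "\<alpha> = rep A (\<sigma>1, 0)"
  have \<alpha>: "\<alpha> \<le> 2" unfolding \<alpha>_def using sidon_A \<sigma>(1) by (simp add: sidon_def zero_prod_def)
  have "card A \<ge> 2" using N_ge v by linarith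
  then have Q: "4 * (N - 4)\<^sup>2 - 2 * N\<^sup>2 + 2 * (6 - N) * (2 - \<alpha>) \<le> Q"
    using fourth_correlation_lower_bound[of "(\<sigma>1, 0)"] \<sigma>(1) unfolding Q_def \<alpha>_def v by (simp add: zero_prod_def)
  have "(\<Sum>a\<in>UNIV. F a 0) = N * (N\<^sup>2 - 16 * N)"
    unfolding F_0 by (rule sum_affine_chi[OF \<sigma>(1)])
  then have "(\<Sum>a\<in>UNIV. \<Sum>c\<in>- {0, b}. F a c)
      = N\<^sup>2 * ((3 * (N - 4)\<^sup>2 - 2 * (N - 4)) - (2 * N + 8) * (N - 4) + (N - 4)\<^sup>2 - Q + (2 * N + 8) * \<alpha>)
        - 2 * (N * (N\<^sup>2 - 16 * N))"
    using quartic_sum_off_b[of \<sigma>1 0 1 "- (2 * N + 8)" "(N - 4)\<^sup>2" "- 1" "2 * N + 8" "- (N - 4)\<^sup>2"] \<sigma>(1)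
    unfolding F_poly v Q_def[symmetric] \<alpha>_def[symmetric]
    by (simp add: zero_prod_def) (simp add: algebra_simps)
  \<comment> \<open>The bound on \<open>Q\<close> is increasing in \<open>\<alpha>\<close>, and \<open>\<alpha>\<close> is at most \<open>2\<close>.\<close>
  also have "\<dots> \<le> 88 * N\<^sup>2"
  proof -
    have "(3 * (N - 4)\<^sup>2 - 2 * (N - 4)) - (2 * N + 8) * (N - 4) + (N - 4)\<^sup>2 - Q + (2 * N + 8) * \<alpha>
        \<le> (3 * (N - 4)\<^sup>2 - 2 * (N - 4)) - (2 * N + 8) * (N - 4) + (N - 4)\<^sup>2
           - (4 * (N - 4)\<^sup>2 - 2 * N\<^sup>2 + 2 * (6 - N) * (2 - \<alpha>)) + (2 * N + 8) * \<alpha>"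
      using Q by simp
    also have "\<dots> = 2 * N + 16 + 20 * \<alpha>"
      by (simp add: power2_eq_square algebra_simps)
    also have "\<dots> \<le> 2 * N + 56" using \<alpha> by simp
    finally have "N\<^sup>2 * ((3 * (N - 4)\<^sup>2 - 2 * (N - 4)) - (2 * N + 8) * (N - 4) + (N - 4)\<^sup>2 - Q + (2 * N + 8) * \<alpha>)
        \<le> N\<^sup>2 * (2 * N + 56)"
      by (intro mult_left_mono) simp_all
    then show ?thesis by (simp add: power2_eq_square algebra_simps)
  qed
  finally have upper: "(\<Sum>a\<in>UNIV. \<Sum>c\<in>- {0, b}. F a c) \<le> 88 * N\<^sup>2" .
  have P_nonneg: "0 \<le> P (T a c)" if "a \<odot> \<sigma>1 = 1" for a c
  proof -
    have "4 dvd T a c - (s - 2)" using T_mod[OF that, of c] s(2) by presburger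
    moreover have "4 dvd 2 * (s - 2)" using s(2) by presburger
    ultimately show ?thesis unfolding P_def using s(3) by (intro gap_poly_nonneg[where d = 4]) auto
  qed
  have "\<exists>a. a \<odot> \<sigma>1 = 1 \<and> (\<forall>c \<in> K 0 - {0}. (T a c)\<^sup>2 = (s - 2)\<^sup>2 \<or> (T a c)\<^sup>2 = (s + 2)\<^sup>2)"
  proof (rule ccontr)
    assume no: "\<not> ?thesis"
    have "96 * N + (- (96 * N)) * chi (a \<odot> \<sigma>1) \<le> (\<Sum>c\<in>- {0, b}. F a c)" for a
    proof (cases "a \<odot> \<sigma>1 = 0")
      case True
      then show ?thesis by (simp add: F_def)
    next
      case False
      then have a: "a \<odot> \<sigma>1 = 1" by simp
      with no obtain c where c: "c \<in> K 0" "c \<noteq> 0" "(T a c)\<^sup>2 \<noteq> (s - 2)\<^sup>2" "(T a c)\<^sup>2 \<noteq> (s + 2)\<^sup>2"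
        by blast
      have "48 * N \<le> P (T a c)"
        unfolding P_def s(1) using s c T_mod[OF a] by (intro gap_poly_large)
      \<comment> \<open>The columns \<open>c\<close> and \<open>c + b\<close> agree, and \<open>F\<close> is twice \<open>P\<close> in this row.\<close>
      then have "192 * N \<le> F a c + F a (c + b)"
        using a by (simp add: F_def T_add_b)
      also have "\<dots> = (\<Sum>c\<in>{c, c + b}. F a c)"
        using b_nonzero by simp
      also have "\<dots> \<le> (\<Sum>c\<in>- {0, b}. F a c)"
      proof (rule sum_mono2)
        have "c \<noteq> b" using c b_notin_K by blast
        then show "{c, c + b} \<subseteq> - {0, b}" using c by (simp add: vec_add_eq_0_iff)
      qed (use a P_nonneg in \<open>auto simp: F_def\<close>)
      finally show ?thesis using a by simp
    qed
    then have "(\<Sum>a\<in>UNIV. 96 * N + (- (96 * N)) * chi (a \<odot> \<sigma>1)) \<le> (\<Sum>a\<in>UNIV. \<Sum>c\<in>- {0, b}. F a c)"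
      by (rule sum_mono)
    with upper have "96 * N\<^sup>2 \<le> 88 * N\<^sup>2"
      unfolding sum_affine_chi[OF \<sigma>(1)] by (simp add: power2_eq_square)
    then show False using N_ge by simp
  qed
  then show ?thesis using that T0 T_mod by blast
qed

text \<open>In a row as in \<open>exists_row_near_root\<close>, \<open>T a c = 2 * \<eta> c + s * \<epsilon> c\<close> with signs \<open>\<eta> c\<close> and \<open>\<epsilon> c\<close> for
\<open>c \<noteq> 0\<close>. The sign \<open>\<eta> c\<close> is determined by \<open>T a c\<close> modulo \<open>8\<close> and is therefore a quadratic character:
\<open>\<eta> c * \<eta> (c + d)\<close> is up to sign a character of \<open>c\<close>. Hence the square of its sum over \<open>K 0\<close> is divisible by the
order of \<open>K 0\<close>, which is \<open>2\<close> to an odd exponent, and the sum itself is divisible by \<open>s\<close>. As in Nyberg's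
argument, the sum of the \<open>\<epsilon> c\<close> would have to be even, but it has an odd number of summands.\<close>

lemma S_not_quadruple:
  assumes S: "card S = 4" and \<sigma>: "\<sigma>1 \<noteq> 0" "\<sigma>2 = 0" and n: "even CARD('n)"
  shows False
proof -
  obtain m0 where m0: "CARD('n) = 2 * m0" using n by (elim evenE)
  define m where "m = m0 - 1"
  have m: "CARD('n) = 2 * (m + 1)" "m \<ge> 2" using m0 dim by (simp_all add: m_def)
  define s :: int where "s = 2 ^ (m + 1)"
  have s: "N = s\<^sup>2"
    unfolding N_def s_def m by (simp only: power_mult mult.commute[of 2])
  have "(2 :: int) ^ 3 dvd s" unfolding s_def using m by (intro le_imp_power_dvd) simp
  then have s8: "8 dvd s" by simp
  then have s8': "8 \<le> s" by (intro zdvd_imp_le) (simp_all add: s_def)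
  obtain a where a: "\<And>c. c \<in> K 0 \<Longrightarrow> c \<noteq> 0 \<Longrightarrow> (T a c)\<^sup>2 = (s - 2)\<^sup>2 \<or> (T a c)\<^sup>2 = (s + 2)\<^sup>2"
    "(T a 0)\<^sup>2 = 4" "\<And>c. 4 dvd T a c - 2"
    using exists_row_near_root[OF S \<sigma> s s8 s8'] by metis
  define \<eta> :: "bit ^ 'n \<Rightarrow> int" where "\<eta> c = (if 8 dvd T a c - 2 then 1 else - 1)" for c
  have \<eta>: "8 dvd T a c - 2 * \<eta> c" "\<eta> c = 1 \<or> \<eta> c = - 1" for c
  proof -
    have "8 dvd t - 2 \<or> 8 dvd t + 2" if "4 dvd t - 2" for t :: int
      using that by presburger
    then show "8 dvd T a c - 2 * \<eta> c" using a(3)[of c] by (auto simp: \<eta>_def)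
  qed (simp add: \<eta>_def)
  have closed: "c + d \<in> K 0 \<longleftrightarrow> c \<in> K 0" if "d \<in> K 0" for c d
    using that by (simp add: K_def dot_add_left)
  have quadratic: "2 ^ (CARD('n) - 1) dvd (\<Sum>c\<in>K 0. \<eta> c * \<eta> (c + d))" for d
  proof -
    let ?Y = "{x. x \<in> - S \<and> d \<odot> G x = 1}"
    define y where "y = (\<Sum>x\<in>?Y. G x)"
    \<comment> \<open>The number of points in \<open>?Y\<close> is necessarily even, since \<open>\<eta> c\<close> and \<open>\<eta> (c + d)\<close> are odd;
      the second branch thus means \<open>2\<close> modulo \<open>4\<close>.\<close>
    define \<kappa> where "\<kappa> = chi (\<Sum>x\<in>?Y. a \<odot> x) * (if 4 dvd int (card ?Y) then 1 else - 1)"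
    have "\<eta> c * \<eta> (c + d) = \<kappa> * chi (c \<odot> y)" for c
    proof -
      have "8 dvd T a (c + d) - T a c + 2 * int (card ?Y) - 2 + 2 * chi (\<Sum>x\<in>?Y. a \<odot> x + c \<odot> G x)"
        using sum_chi_add_mod_8[of "- S" "\<lambda>x. a \<odot> x + c \<odot> G x" "\<lambda>x. d \<odot> G x"]
        by (simp add: T_eq dot_add_left add.assoc)
      also have "(\<Sum>x\<in>?Y. a \<odot> x + c \<odot> G x) = (\<Sum>x\<in>?Y. a \<odot> x) + c \<odot> y"
        by (simp only: sum.distrib dot_sum_right y_def)
      finally have "8 dvd T a (c + d) - T a c + 2 * int (card ?Y) - 2 + 2 * (chi (\<Sum>x\<in>?Y. a \<odot> x) * chi (c \<odot> y))"
        by (simp add: chi_add)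
      moreover note \<eta>[of c] \<eta>[of "c + d"] chi_cases[of "\<Sum>x\<in>?Y. a \<odot> x"] chi_cases[of "c \<odot> y"]
      ultimately show ?thesis
        unfolding \<kappa>_def by (elim disjE) (simp_all, presburger+)
    qed
    then have "(\<Sum>c\<in>K 0. \<eta> c * \<eta> (c + d)) = \<kappa> * (\<Sum>c\<in>K 0. chi (c \<odot> y))"
      by (simp add: sum_distrib_left)
    then show ?thesis using dvd_sum_chi_K_0 by (simp add: dvd_mult)
  qed
  have "(\<Sum>c\<in>K 0. \<eta> c)\<^sup>2 = (\<Sum>c\<in>K 0. \<Sum>c'\<in>K 0. \<eta> c * \<eta> c')"
    by (simp add: power2_eq_square sum_product)
  also have "\<dots> = (\<Sum>c\<in>K 0. \<Sum>d\<in>K 0. \<eta> c * \<eta> (c + d))"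
  proof (rule sum.cong[OF refl])
    fix c assume "c \<in> K 0"
    then show "(\<Sum>c'\<in>K 0. \<eta> c * \<eta> c') = (\<Sum>d\<in>K 0. \<eta> c * \<eta> (c + d))"
      by (intro sum.reindex_bij_witness[of _ "\<lambda>d. c + d" "\<lambda>d. c + d"]) (auto simp: closed)
  qed
  also have "\<dots> = (\<Sum>d\<in>K 0. \<Sum>c\<in>K 0. \<eta> c * \<eta> (c + d))"
    by (rule sum.swap)
  finally have "2 ^ (2 * m + 1) dvd (\<Sum>c\<in>K 0. \<eta> c)\<^sup>2"
    using quadratic m(1) by (simp add: dvd_sum)
  then have s_dvd: "s dvd (\<Sum>c\<in>K 0. \<eta> c)"
    unfolding s_def by (rule power_dvd_of_square)
  have T0: "T a 0 = 2 * \<eta> 0"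
  proof -
    have "T a 0 = 2 \<or> T a 0 = - 2" using a(2) power2_eq_iff[of "T a 0" 2] by simp
    then show ?thesis using \<eta>[of 0] by auto
  qed
  define \<epsilon> :: "bit ^ 'n \<Rightarrow> int" where "\<epsilon> c = (if T a c - 2 * \<eta> c = s then 1 else - 1)" for c
  have \<epsilon>: "T a c - 2 * \<eta> c = s * \<epsilon> c" if "c \<in> K 0 - {0}" for c
  proof -
    have "T a c = s - 2 \<or> T a c = - (s - 2) \<or> T a c = s + 2 \<or> T a c = - (s + 2)"
      using a(1)[of c] that by (auto simp: power2_eq_iff)
    then have "T a c - 2 * \<eta> c = s \<or> T a c - 2 * \<eta> c = - s"
      using \<eta>[of c] s8 s8' by presburger
    then show ?thesis by (auto simp: \<epsilon>_def)
  qed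
  have "odd (\<Sum>c\<in>K 0 - {0}. \<epsilon> c)"
  proof -
    have "{c \<in> K 0 - {0}. odd (\<epsilon> c)} = K 0 - {0}" by (auto simp: \<epsilon>_def)
    then show ?thesis using odd_card_K_minus_0[of 0] by (simp add: even_sum_iff)
  qed
  moreover have "(\<Sum>c\<in>K 0. T a c) - 2 * (\<Sum>c\<in>K 0. \<eta> c) = s * (\<Sum>c\<in>K 0 - {0}. \<epsilon> c)"
  proof -
    have "(\<Sum>c\<in>K 0. T a c) - 2 * (\<Sum>c\<in>K 0. \<eta> c) = (\<Sum>c\<in>K 0. T a c - 2 * \<eta> c)"
      by (simp add: sum_subtractf sum_distrib_left)
    also have "\<dots> = (\<Sum>c\<in>K 0 - {0}. T a c - 2 * \<eta> c)"
      by (subst sum.remove[OF finite zero_in_K]) (simp add: T0)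
    also have "\<dots> = s * (\<Sum>c\<in>K 0 - {0}. \<epsilon> c)"
      unfolding sum_distrib_left by (intro sum.cong refl \<epsilon>)
    finally show ?thesis .
  qed
  moreover have "2 * s dvd (\<Sum>c\<in>K 0. T a c) - 2 * (\<Sum>c\<in>K 0. \<eta> c)"
  proof (rule dvd_diff)
    have "2 * s dvd 2 ^ (CARD('n) - 2)"
      unfolding s_def power_Suc[symmetric] using m by (intro le_imp_power_dvd) simp
    then show "2 * s dvd (\<Sum>c\<in>K 0. T a c)"
      using dvd_sum_T_K by (rule dvd_trans)
    show "2 * s dvd 2 * (\<Sum>c\<in>K 0. \<eta> c)"
      using s_dvd by simp
  qed
  ultimately show False
    using s8' by (simp add: mult.commute[of 2])
qed

end

section \<open>Distance four: the support is an affine plane\<close>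

text \<open>Four points of sum zero form an affine plane. The values of \<open>G\<close> at \<open>s\<close>, \<open>s + h1\<close> and \<open>s + h2\<close> can
be made equal by adding a linear map. At frequencies orthogonal to \<open>(0, y0)\<close>, with \<open>y0\<close> as below, the
character sum over \<open>S\<close> is then a product.\<close>

locale flat_component = sparse_component G b S N
  for G :: "bit ^ 'n \<Rightarrow> bit ^ 'n" and b S N +
  fixes s h1 h2 :: "bit ^ 'n"
  assumes S_flat: "S = {s, s + h1, s + h2, s + h1 + h2}"
    and h: "h1 \<noteq> 0" "h2 \<noteq> 0" "h1 \<noteq> h2"
    and G_flat: "G (s + h1) = G s" "G (s + h2) = G s"
    and even_dim: "even CARD('n)"
begin

text \<open>This is the sum of \<open>G\<close> over all of \<open>S\<close>: the first three values agree, and two of them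
cancel.\<close>

definition y0 :: "bit ^ 'n" where "y0 = G s + G (s + h1 + h2)"

lemma h_sum_nonzero: "h1 + h2 \<noteq> 0"
  using h by (simp add: vec_add_eq_0_iff)

lemma sum_S: "(\<Sum>x\<in>S. f x) = f s + f (s + h1) + f (s + h2) + f (s + h1 + h2)" for f :: "bit ^ 'n \<Rightarrow> 'c :: comm_monoid_add"
proof -
  have "s \<notin> {s + h1, s + h2, s + h1 + h2}" "s + h1 \<notin> {s + h2, s + h1 + h2}" "s + h2 \<notin> {s + h1 + h2}"
    using h h_sum_nonzero by (auto simp: add.assoc)
  then show ?thesis
    unfolding S_flat by (simp add: add.assoc)
qed

lemma card_S: "card S = 4"
  using sum_S[of "\<lambda>_. 1 :: nat"] by simp

lemma card_A_flat: "int (card A) = N - 4"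
  unfolding card_A card_S by simp

lemma b_dot_y0: "b \<odot> y0 = 0"
  by (simp add: y0_def dot_add_right component S_flat)

lemma sigma_flat: "\<sigma>1 = 0" "\<sigma>2 = y0"
proof -
  have "s + (s + h1) + (s + h2) + (s + h1 + h2) = ((s + s) + (s + s)) + ((h1 + h1) + (h2 + h2))"
    by (simp only: add_ac)
  then show "\<sigma>1 = 0" unfolding \<sigma>1_def sum_S by simp
  show "\<sigma>2 = y0" unfolding \<sigma>2_def sum_S y0_def G_flat by simp
qed

lemma shift_S: "x + h1 \<in> S \<longleftrightarrow> x \<in> S" "x + h2 \<in> S \<longleftrightarrow> x \<in> S" "x + (h1 + h2) \<in> S \<longleftrightarrow> x \<in> S"
proof -
  have *: "y + h1 \<in> S" "y + h2 \<in> S" if "y \<in> S" for y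
  proof -
    have "s + h2 + h1 = s + h1 + h2" by (simp add: add_ac)
    moreover have "s + h1 + h2 + h1 = s + h2"
      unfolding add.assoc add.commute[of h2 h1] by simp
    ultimately show "y + h1 \<in> S" "y + h2 \<in> S" using that by (auto simp: S_flat)
  qed
  have **: "x + h1 \<in> S \<longleftrightarrow> x \<in> S" "x + h2 \<in> S \<longleftrightarrow> x \<in> S" for x
    using *(1)[of x] *(1)[of "x + h1"] *(2)[of x] *(2)[of "x + h2"] unfolding vec_add_self_right by blast+
  show "x + h1 \<in> S \<longleftrightarrow> x \<in> S" "x + h2 \<in> S \<longleftrightarrow> x \<in> S" by (fact **)+
  show "x + (h1 + h2) \<in> S \<longleftrightarrow> x \<in> S" using ** by (simp flip: add.assoc)
qed

text \<open>If \<open>G\<close> were constant on \<open>S\<close>, its derivative in the direction \<open>h1\<close> would vanish at four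
points.\<close>

lemma y0_nonzero: "y0 \<noteq> 0"
proof
  assume "y0 = 0"
  then have "G (s + h1 + h2) = G s" by (simp add: y0_def vec_add_eq_0_iff)
  then have "S \<subseteq> {x. G (x + h1) + G x = 0}"
    by (auto simp: S_flat G_flat add.assoc add.commute[of h2 h1])
  then have "card S \<le> card {x. G (x + h1) + G x = 0}"
    by (intro card_mono) auto
  then show False
    using card_derivative_fibre[OF h(1), of 0] card_S by simp
qed

lemma T_0_flat: "T a 0 = (if a = 0 then N else 0) - chi (a \<odot> s) * ((1 + chi (a \<odot> h1)) * (1 + chi (a \<odot> h2)))"
  unfolding T_0 sum_S by (simp add: dot_add_right chi_add algebra_simps)

text \<open>The component \<open>b \<odot> G\<close> is invariant under translation by \<open>d\<close>, so the derivative of \<open>G\<close> in the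
direction \<open>d\<close> takes its values in the hyperplane orthogonal to \<open>b\<close>. As it takes each value at most twice, it
takes each value of the hyperplane exactly twice.\<close>

lemma derivative_sum_zero:
  assumes d: "d \<noteq> 0" "\<And>x. x + d \<in> S \<longleftrightarrow> x \<in> S" and c: "c \<noteq> 0" "c \<noteq> b"
  shows "(\<Sum>x\<in>UNIV. chi (c \<odot> (G (x + d) + G x))) = 0"
proof -
  \<comment> \<open>The pointwise bound \<open>n y \<le> 1 + chi (y \<odot> b)\<close> has equal sums on both sides, so it is an
    equality.\<close>
  define n where "n y = int (card {x. G (x + d) + G x = y})" for y
  have n_le: "n y \<le> 1 + chi (y \<odot> b)" for y
  proof (cases "y \<odot> b = 0")
    case True
    then show ?thesis using card_derivative_fibre[OF d(1), of y] by (simp add: n_def)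
  next
    case False
    then have "{x. G (x + d) + G x = y} = {}"
      using d(2) by (auto simp: dot_commute[of _ b] dot_add_right component)
    then show ?thesis using False unfolding n_def by (simp only: card.empty) simp
  qed
  have sum_n: "(\<Sum>x\<in>UNIV. f (G (x + d) + G x)) = (\<Sum>y\<in>UNIV. n y * f y)" for f :: "bit ^ 'n \<Rightarrow> int"
    using sum.group[of UNIV UNIV "\<lambda>x. G (x + d) + G x" "\<lambda>x. f (G (x + d) + G x)"]
    by (simp add: n_def)
  have "(\<Sum>y\<in>UNIV. 1 + chi (y \<odot> b) - n y) = 0"
    using sum_n[of "\<lambda>_. 1"] b_nonzero by (simp add: sum_subtractf sum.distrib sum_chi_dot_N N_def)
  then have n: "n y = 1 + chi (y \<odot> b)" for y
    using n_le by (subst (asm) sum_nonneg_eq_0_iff) auto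
  have "(\<Sum>x\<in>UNIV. chi (c \<odot> (G (x + d) + G x))) = (\<Sum>y\<in>UNIV. chi (y \<odot> c) + chi (y \<odot> (b + c)))"
    unfolding sum_n[of "\<lambda>y. chi (c \<odot> y)"] n by (simp add: dot_commute[of c] dot_add_right chi_add algebra_simps)
  also have "\<dots> = 0"
    using c by (simp add: sum.distrib sum_chi_dot_N vec_add_eq_0_iff)
  finally show ?thesis .
qed

lemma row_second_moment:
  "(\<Sum>a\<in>UNIV. (T a c)\<^sup>2 * chi (a \<odot> d)) = N * (\<Sum>x\<in>- S. if x + d \<in> S then 0 else chi (c \<odot> (G (x + d) + G x)))"
proof -
  have "(\<Sum>a\<in>UNIV. (T a c)\<^sup>2 * chi (a \<odot> d))
      = (\<Sum>a\<in>UNIV. \<Sum>x\<in>- S. \<Sum>y\<in>- S. chi (c \<odot> (G y + G x)) * chi (a \<odot> (x + y + d)))"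
    unfolding T_eq power2_eq_square sum_product unfolding sum_distrib_right dot_add_right chi_add
    by (simp only: mult_ac)
  also have "\<dots> = (\<Sum>x\<in>- S. \<Sum>a\<in>UNIV. \<Sum>y\<in>- S. chi (c \<odot> (G y + G x)) * chi (a \<odot> (x + y + d)))"
    by (rule sum.swap)
  also have "\<dots> = (\<Sum>x\<in>- S. \<Sum>y\<in>- S. \<Sum>a\<in>UNIV. chi (c \<odot> (G y + G x)) * chi (a \<odot> (x + y + d)))"
    by (rule sum.cong[OF refl], rule sum.swap)
  also have "\<dots> = (\<Sum>x\<in>- S. \<Sum>y\<in>- S. if y = x + d then N * chi (c \<odot> (G (x + d) + G x)) else 0)"
  proof (intro sum.cong refl)
    fix x y
    have "x + y + d = 0 \<longleftrightarrow> y = x + d"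
      using vec_add_eq_0_iff[of y "x + d"] by (simp add: add_ac)
    then show "(\<Sum>a\<in>UNIV. chi (c \<odot> (G y + G x)) * chi (a \<odot> (x + y + d)))
        = (if y = x + d then N * chi (c \<odot> (G (x + d) + G x)) else 0)"
      by (simp add: sum_chi_dot_N flip: sum_distrib_left)
  qed
  also have "\<dots> = N * (\<Sum>x\<in>- S. if x + d \<in> S then 0 else chi (c \<odot> (G (x + d) + G x)))"
    unfolding sum_distrib_left by (intro sum.cong refl) simp
  finally show ?thesis .
qed

lemma row_second_moment_0: "(\<Sum>a\<in>UNIV. (T a c)\<^sup>2) = N * (N - 4)"
proof -
  have "int (card (- S)) = N - 4"
    using card_A_flat unfolding A_def by (simp add: card_image inj_on_def)
  then show ?thesis
    using row_second_moment[of c 0] by simp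
qed

text \<open>Since \<open>G\<close> has balanced derivatives in the directions of \<open>S\<close>, only the four points that were cut
out of the graph contribute.\<close>

lemma row_second_moment_flat:
  assumes d: "d \<in> {h1, h2, h1 + h2}" and c: "c \<noteq> 0" "c \<noteq> b" "c \<odot> y0 = 0"
  shows "(\<Sum>a\<in>UNIV. (T a c)\<^sup>2 * chi (a \<odot> d)) = - 4 * N"
proof -
  have d_S: "x + d \<in> S \<longleftrightarrow> x \<in> S" for x
    using d shift_S by auto
  have "d \<noteq> 0" using d h h_sum_nonzero by auto
  then have "(\<Sum>x\<in>UNIV. chi (c \<odot> (G (x + d) + G x))) = 0"
    using d_S c by (intro derivative_sum_zero) auto
  moreover have "(\<Sum>x\<in>S. chi (c \<odot> (G (x + d) + G x))) = 4"
  proof -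
    have "c \<odot> G x = c \<odot> G s" if "x \<in> S" for x
    proof -
      have "c \<odot> G s + c \<odot> G (s + h1 + h2) = 0"
        using c(3) by (simp add: y0_def dot_add_right)
      then have "c \<odot> G (s + h1 + h2) = c \<odot> G s"
        by (cases "c \<odot> G s"; cases "c \<odot> G (s + h1 + h2)") simp_all
      then show ?thesis using that by (auto simp: S_flat G_flat)
    qed
    then have "chi (c \<odot> (G (x + d) + G x)) = 1" if "x \<in> S" for x
      using that d_S by (simp add: dot_add_right)
    then show ?thesis by (simp add: card_S)
  qed
  ultimately have "(\<Sum>x\<in>- S. chi (c \<odot> (G (x + d) + G x))) = - 4"
    using sum.subset_diff[of S UNIV "\<lambda>x. chi (c \<odot> (G (x + d) + G x))"] by (simp add: Compl_eq_Diff_UNIV)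
  then show ?thesis
    unfolding row_second_moment by (simp add: d_S)
qed

text \<open>The character sum over the full graph is congruent to \<open>2 - 2 * \<kappa> * chi (a \<odot> \<mu>)\<close> modulo \<open>8\<close>. The
points of \<open>S\<close> contribute plus or minus \<open>4\<close> if \<open>a\<close> is orthogonal to \<open>h1\<close> and \<open>h2\<close>, and nothing otherwise. The
product with \<open>\<kappa>\<close> in the statement is \<open>2\<close> if \<open>T a c\<close> is divisible by \<open>8\<close> and \<open>- 2\<close> if it is \<open>4\<close> modulo
\<open>8\<close>.\<close>

lemma row_mod_8:
  assumes c: "c \<odot> y0 = 0"
  obtains \<kappa> \<mu> where "\<kappa> = 1 \<or> \<kappa> = - 1"
    "\<And>a. 8 dvd T a c - 2 + \<kappa> * (chi (a \<odot> \<mu>) * (1 - chi (a \<odot> h1) - chi (a \<odot> h2) - chi (a \<odot> (h1 + h2))))"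
proof -
  let ?Y = "{x \<in> UNIV. c \<odot> G x = 1}"
  define \<mu> where "\<mu> = (\<Sum>x\<in>?Y. x)"
  define \<kappa> :: int where "\<kappa> = (if 4 dvd int (card ?Y) then 1 else - 1)"
  have "(- 1 :: int) ^ card ?Y = chi (\<Sum>x\<in>UNIV. c \<odot> G x)"
    by (simp add: chi_sum_bits)
  also have "\<dots> = 1" using sum_G by (simp flip: dot_sum_right)
  finally have even_Y: "even (int (card ?Y))"
    by (cases "even (card ?Y)") simp_all
  have "8 dvd T a c - 2 + \<kappa> * (chi (a \<odot> \<mu>) * (1 - chi (a \<odot> h1) - chi (a \<odot> h2) - chi (a \<odot> (h1 + h2))))" for a
  proof -
    have c_S: "c \<odot> G (s + h1 + h2) = c \<odot> G s"
      using c unfolding y0_def dot_add_right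
      by (cases "c \<odot> G s"; cases "c \<odot> G (s + h1 + h2)") simp_all
    \<comment> \<open>Here \<open>\<delta>\<close> is the contribution of \<open>S\<close> to the full character sum.\<close>
    define \<delta> where "\<delta> = chi (a \<odot> s + c \<odot> G s) * ((1 + chi (a \<odot> h1)) * (1 + chi (a \<odot> h2)))"
    have "(\<Sum>x\<in>S. chi (a \<odot> x + c \<odot> G x)) = \<delta>"
      unfolding sum_S \<delta>_def c_S G_flat by (simp add: dot_add_right chi_add algebra_simps)
    then have W: "(\<Sum>x\<in>UNIV. chi (a \<odot> x + c \<odot> G x)) = T a c + \<delta>"
      using sum.subset_diff[of S UNIV "\<lambda>x. chi (a \<odot> x + c \<odot> G x)"]
      by (simp add: T_eq Compl_eq_Diff_UNIV)
    have m1: "8 dvd (\<Sum>x\<in>UNIV. chi (a \<odot> x))"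
      using N_dvd sum_chi_dot_N[of a] by (simp add: dot_commute[of a], presburger)
    have m2: "(\<Sum>x\<in>?Y. a \<odot> x) = a \<odot> \<mu>"
      by (simp only: dot_sum_right \<mu>_def)
    have "8 dvd T a c + \<delta> - (\<Sum>x\<in>UNIV. chi (a \<odot> x)) + 2 * int (card ?Y) - 2 + 2 * chi (a \<odot> \<mu>)"
      using sum_chi_add_mod_8[of UNIV "\<lambda>x. a \<odot> x" "\<lambda>x. c \<odot> G x", OF finite] unfolding W m2 .
    from dvd_add[OF this m1] have "8 dvd T a c + \<delta> + 2 * int (card ?Y) - 2 + 2 * chi (a \<odot> \<mu>)"
      by (simp add: algebra_simps)
    moreover have "(\<kappa> = 1 \<and> 4 dvd int (card ?Y)) \<or> (\<kappa> = - 1 \<and> 4 dvd int (card ?Y) - 2)"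
      using even_Y unfolding \<kappa>_def by presburger
    moreover have "8 dvd t - 2 + 2 * (k * x)"
      if "8 dvd t + 2 * y - 2 + 2 * x" "(k = 1 \<and> 4 dvd y) \<or> (k = - 1 \<and> 4 dvd y - 2)" "x = 1 \<or> x = - 1"
      for t k x y :: int
      using that by (elim disjE conjE; hypsubst; presburger)
    ultimately have d1: "8 dvd T a c + \<delta> - 2 + 2 * (\<kappa> * chi (a \<odot> \<mu>))"
      using chi_cases[of "a \<odot> \<mu>"] by blast
    have d2: "8 dvd \<delta> + 2 * (\<kappa> * chi (a \<odot> \<mu>))
        - \<kappa> * (chi (a \<odot> \<mu>) * (1 - chi (a \<odot> h1) - chi (a \<odot> h2) - chi (a \<odot> (h1 + h2))))"
      using chi_cases[of "a \<odot> \<mu>"] chi_cases[of "a \<odot> h1"] chi_cases[of "a \<odot> h2"] chi_cases[of "a \<odot> s + c \<odot> G s"]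
      unfolding \<delta>_def dot_add_right[of a h1] chi_add[of "a \<odot> h1"] \<kappa>_def
      by (elim disjE) simp_all
    from dvd_diff[OF d1 d2] show ?thesis by (simp add: algebra_simps)
  qed
  then show ?thesis using that[of \<kappa> \<mu>] by (simp add: \<kappa>_def)
qed

text \<open>Where \<open>T a c\<close> is \<open>4\<close> modulo \<open>8\<close>, the quartic with roots \<open>w - 4\<close> and \<open>w + 4\<close> bounds \<open>(T\<^sup>2 - N)\<^sup>2\<close>
from below by a quadratic polynomial in \<open>T\<close>. The total of these bounds follows from the second moments of the
column. The least possible total occurs when \<open>T a c\<close> is \<open>4\<close> modulo \<open>8\<close> exactly for those \<open>a\<close> that are
orthogonal to \<open>h1\<close> and \<open>h2\<close>, that is for \<open>\<mu> = 0\<close> and \<open>\<kappa> = 1\<close>; equality then forces \<open>T\<^sup>2 = N\<close> for all other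
\<open>a\<close>.\<close>

lemma row_energy:
  assumes c: "c \<noteq> 0" "c \<noteq> b" "c \<odot> y0 = 0" and w: "N = w\<^sup>2" "8 dvd w" "8 \<le> w"
  shows "N * (16 * N - 192) \<le> (\<Sum>a\<in>UNIV. ((T a c)\<^sup>2 - N)\<^sup>2)"
    and "(\<Sum>a\<in>UNIV. ((T a c)\<^sup>2 - N)\<^sup>2) = N * (16 * N - 192) \<Longrightarrow> a \<odot> h1 = 1 \<Longrightarrow> (T a c)\<^sup>2 = N"
proof -
  obtain \<kappa> \<mu> where \<kappa>: "\<kappa> = 1 \<or> \<kappa> = - 1"
    and T_mod: "8 dvd T a c - 2 + \<kappa> * (chi (a \<odot> \<mu>) * (1 - chi (a \<odot> h1) - chi (a \<odot> h2) - chi (a \<odot> (h1 + h2))))" for a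
    using row_mod_8[OF c(3)] by metis
  define \<Theta> where "\<Theta> a = \<kappa> * (chi (a \<odot> \<mu>) * (1 - chi (a \<odot> h1) - chi (a \<odot> h2) - chi (a \<odot> (h1 + h2))))" for a
  define E where "E a = ((T a c)\<^sup>2 - N)\<^sup>2" for a
  define B where "B a = (2 - \<Theta> a) * (32 * (T a c)\<^sup>2 + (32 * N - 256))" for a
  have \<Theta>: "\<Theta> a = 2 \<or> \<Theta> a = - 2" for a
    using \<kappa> chi_cases[of "a \<odot> \<mu>"] chi_cases[of "a \<odot> h1"] chi_cases[of "a \<odot> h2"]
    unfolding \<Theta>_def dot_add_right chi_add by (elim disjE) simp_all
  have B_le: "B a \<le> 4 * E a" for a
  proof (cases "\<Theta> a = 2")
    case True
    then show ?thesis by (simp add: B_def E_def)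
  next
    case False
    then have \<Theta>': "\<Theta> a = - 2" using \<Theta>[of a] by simp
    then have "8 dvd T a c - 4" using T_mod[of a] by (simp add: \<Theta>_def)
    then have "8 dvd T a c - (w - 4)" "8 dvd 2 * (w - 4)" using w(2) by presburger+
    then have "0 \<le> ((T a c)\<^sup>2 - (w - 4)\<^sup>2) * ((T a c)\<^sup>2 - (w + 4)\<^sup>2)"
      using w(3) by (intro gap_poly_nonneg[where d = 8]) auto
    then have "32 * (T a c)\<^sup>2 + (32 * N - 256) \<le> E a"
      unfolding E_def w(1) by (simp add: power2_eq_square algebra_simps)
    then show ?thesis by (simp add: B_def \<Theta>')
  qed
  define R where "R d = (\<Sum>a\<in>UNIV. (T a c)\<^sup>2 * chi (a \<odot> d))" for d
  have R: "R 0 = N * (N - 4)" "R h1 = - 4 * N" "R h2 = - 4 * N" "R (h1 + h2) = - 4 * N"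
    unfolding R_def using row_second_moment_0 row_second_moment_flat c by simp_all
  have \<Theta>_eq: "\<Theta> a = \<kappa> * (chi (a \<odot> \<mu>) - chi (a \<odot> (\<mu> + h1)) - chi (a \<odot> (\<mu> + h2)) - chi (a \<odot> (\<mu> + (h1 + h2))))" for a
    unfolding \<Theta>_def dot_add_right chi_add by (simp add: algebra_simps)
  have sum_\<Theta>: "(\<Sum>a\<in>UNIV. \<Theta> a) = \<kappa> * N * (of_bool (\<mu> = 0) - of_bool (\<mu> = h1) - of_bool (\<mu> = h2) - of_bool (\<mu> = h1 + h2))"
    unfolding \<Theta>_eq sum_distrib_left[symmetric] sum_subtractf sum_chi_dot_N vec_add_eq_0_iff
    by (simp add: algebra_simps of_bool_def)
  have sum_T\<Theta>: "(\<Sum>a\<in>UNIV. (T a c)\<^sup>2 * \<Theta> a) = \<kappa> * (R \<mu> - R (\<mu> + h1) - R (\<mu> + h2) - R (\<mu> + (h1 + h2)))"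
    unfolding \<Theta>_eq R_def sum_subtractf[symmetric] sum_distrib_left
    by (intro sum.cong refl) (simp add: algebra_simps)
  have sum_B: "(\<Sum>a\<in>UNIV. B a) = (2 * N - (\<Sum>a\<in>UNIV. \<Theta> a)) * (32 * N - 256)
      + 32 * (2 * R 0 - (\<Sum>a\<in>UNIV. (T a c)\<^sup>2 * \<Theta> a))"
  proof -
    define C where "C = 32 * N - 256"
    have "B a = 2 * C - C * \<Theta> a + 64 * (T a c)\<^sup>2 - 32 * ((T a c)\<^sup>2 * \<Theta> a)" for a
      unfolding B_def C_def by (simp add: algebra_simps)
    then have "(\<Sum>a\<in>UNIV. B a) = N * (2 * C) - C * (\<Sum>a\<in>UNIV. \<Theta> a)
        + 64 * (\<Sum>a\<in>UNIV. (T a c)\<^sup>2) - 32 * (\<Sum>a\<in>UNIV. (T a c)\<^sup>2 * \<Theta> a)"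
      unfolding sum_const_UNIV[symmetric] by (simp only: sum.distrib sum_subtractf sum_distrib_left)
    then show ?thesis by (simp add: R_def C_def algebra_simps)
  qed
  have T\<Theta>_le: "(\<Sum>a\<in>UNIV. (T a c)\<^sup>2 * \<Theta> a) \<le> 2 * R 0"
  proof -
    have "(T a c)\<^sup>2 * \<Theta> a \<le> 2 * ((T a c)\<^sup>2 * chi (a \<odot> 0))" for a
      using \<Theta>[of a] by auto
    then show ?thesis unfolding R_def sum_distrib_left by (intro sum_mono)
  qed
  define M where "M = N * (16 * N - 192)"
  have B_large: "4 * M < (\<Sum>a\<in>UNIV. B a)" if not_tight: "\<not> (\<mu> = 0 \<and> \<kappa> = 1)"
  proof -
    have N: "N > 0" using N_ge by simp
    \<comment> \<open>Unless at least half of the values are \<open>4\<close> modulo \<open>8\<close>, these values fill one of the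
      other three cosets of the orthogonal space of \<open>h1\<close> and \<open>h2\<close>.\<close>
    consider "(\<Sum>a\<in>UNIV. \<Theta> a) \<le> 0" | "\<kappa> = - 1" "\<mu> \<in> {h1, h2, h1 + h2}"
    proof -
      have "(\<Sum>a\<in>UNIV. \<Theta> a) \<le> 0 \<or> (\<kappa> = - 1 \<and> \<mu> \<in> {h1, h2, h1 + h2})"
        using \<kappa> not_tight N h h_sum_nonzero unfolding sum_\<Theta> by (cases "\<mu> = 0") auto
      then show thesis using that by blast
    qed
    then show ?thesis
    proof cases
      case 1
      have "4 * M < 2 * N * (32 * N - 256)"
        using N by (simp add: M_def algebra_simps)
      also have "\<dots> \<le> (2 * N - (\<Sum>a\<in>UNIV. \<Theta> a)) * (32 * N - 256)"
        using 1 N_ge by (intro mult_right_mono) auto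
      also have "\<dots> \<le> (\<Sum>a\<in>UNIV. B a)"
        unfolding sum_B using T\<Theta>_le by simp
      finally show ?thesis .
    next
      case 2
      have "(\<Sum>a\<in>UNIV. \<Theta> a) = N"
        unfolding sum_\<Theta> using 2 h h_sum_nonzero by auto
      moreover have "(\<Sum>a\<in>UNIV. (T a c)\<^sup>2 * \<Theta> a) = N * (N - 8)"
        unfolding sum_T\<Theta> using 2
        by (auto simp: R add_ac) (simp_all add: R add.commute[of h2 h1] algebra_simps)
      ultimately show ?thesis
        unfolding sum_B R M_def using N by (simp add: algebra_simps)
    qed
  qed
  have sum_B_le: "(\<Sum>a\<in>UNIV. B a) \<le> 4 * (\<Sum>a\<in>UNIV. E a)"
    unfolding sum_distrib_left by (rule sum_mono) (rule B_le)
  have B_tight: "(\<Sum>a\<in>UNIV. B a) = 4 * M" if "\<mu> = 0" "\<kappa> = 1"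
    unfolding sum_B sum_\<Theta> sum_T\<Theta> M_def using that h h_sum_nonzero by (simp add: R algebra_simps)
  show "N * (16 * N - 192) \<le> (\<Sum>a\<in>UNIV. ((T a c)\<^sup>2 - N)\<^sup>2)"
    using B_large B_tight sum_B_le unfolding M_def[symmetric] E_def[symmetric] by linarith
  show "(T a c)\<^sup>2 = N" if "(\<Sum>a\<in>UNIV. ((T a c)\<^sup>2 - N)\<^sup>2) = N * (16 * N - 192)" "a \<odot> h1 = 1" for a
  proof -
    have E: "(\<Sum>a\<in>UNIV. E a) = M" using that(1) by (simp add: E_def M_def)
    with B_large sum_B_le have \<mu>: "\<mu> = 0" "\<kappa> = 1" by linarith+
    have "(\<Sum>a\<in>UNIV. 4 * E a - B a) = 0"
      using B_tight[OF \<mu>] E by (simp add: sum_subtractf flip: sum_distrib_left)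
    then have "4 * E a - B a = 0"
      using B_le by (subst (asm) sum_nonneg_eq_0_iff) auto
    moreover have "\<Theta> a = 2"
      unfolding \<Theta>_def \<mu> using that(2) by (simp add: dot_add_right chi_add)
    ultimately show ?thesis by (simp add: B_def E_def)
  qed
qed

text \<open>In the columns with \<open>c \<odot> y0 = 1\<close> all values of \<open>T\<close> are \<open>2\<close> modulo \<open>4\<close>, and the quartic with roots
\<open>w - 2\<close> and \<open>w + 2\<close> is nonnegative. Together with the lower bound for the columns with \<open>c \<odot> y0 = 0\<close> this
exhausts the fourth moment, so equality holds in each of the latter columns, and Nyberg's argument applies to
any row with \<open>a \<odot> h1 = 1\<close>.\<close>

lemma contradiction: False
proof -
  obtain m where m: "CARD('n) = 2 * m" using even_dim by (elim evenE)
  define w :: int where "w = 2 ^ m"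
  have w: "N = w\<^sup>2" unfolding N_def w_def m by (simp only: power_mult mult.commute[of 2])
  have "(2 :: int) ^ 3 dvd w" unfolding w_def using m dim by (intro le_imp_power_dvd) simp
  then have w8: "8 dvd w" by simp
  then have w8': "8 \<le> w" by (intro zdvd_imp_le) (simp_all add: w_def)
  define P where "P x = (x\<^sup>2 - (w - 2)\<^sup>2) * (x\<^sup>2 - (w + 2)\<^sup>2)" for x
  have P: "P x = x ^ 4 - (2 * N + 8) * x\<^sup>2 + (N - 4)\<^sup>2" for x
    unfolding P_def w by (simp add: power2_eq_square power4_eq_xxxx algebra_simps)
  define F where "F a c = (1 - chi (c \<odot> y0)) * P (T a c) + (1 + chi (c \<odot> y0)) * ((T a c)\<^sup>2 - N)\<^sup>2" for a c
  have F_poly: "F a c = 2 * T a c ^ 4 + (- (4 * N + 8)) * (T a c)\<^sup>2 + ((N - 4)\<^sup>2 + N\<^sup>2)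
      + (0 * T a c ^ 4 + 8 * (T a c)\<^sup>2 + (N\<^sup>2 - (N - 4)\<^sup>2)) * chi (a \<odot> 0 + c \<odot> y0)" for a c
    unfolding F_def P by (simp add: power2_eq_square power4_eq_xxxx algebra_simps)
  have F_0: "F a 0 = (if a = 0 then 2 * ((N - 4)\<^sup>2 - N)\<^sup>2 - 0 else
      2 * N\<^sup>2 + (128 - 16 * N) * ((1 + chi (a \<odot> h1)) + (chi (a \<odot> h2) + chi (a \<odot> (h1 + h2)))))" for a
  proof (cases "a = 0")
    case True
    then show ?thesis
      unfolding F_def T_0_flat[of a] by (simp add: power2_eq_square algebra_simps)
  next
    case False
    then show ?thesis
      using chi_cases[of "a \<odot> s"] chi_cases[of "a \<odot> h1"] chi_cases[of "a \<odot> h2"]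
      unfolding F_def T_0_flat[of a] dot_add_right chi_add
      by (elim disjE) (simp_all add: power2_eq_square algebra_simps)
  qed
  have rep: "rep A (0, y0) = 0"
  proof -
    have "{x. x \<notin> S \<and> x + 0 \<notin> S \<and> G (x + 0) + G x = y0} = {}" using y0_nonzero by auto
    then show ?thesis unfolding rep_A by (simp only: card.empty)
  qed
  have sum_F0: "(\<Sum>a\<in>UNIV. F a 0) = N * (2 * N\<^sup>2 + (128 - 16 * N)) - (2 * N\<^sup>2 + (128 - 16 * N) * 4) + 2 * ((N - 4)\<^sup>2 - N)\<^sup>2"
  proof -
    have "(\<Sum>a\<in>UNIV. 2 * N\<^sup>2 + (128 - 16 * N) * ((1 + chi (a \<odot> h1)) + (chi (a \<odot> h2) + chi (a \<odot> (h1 + h2)))))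
        = N * (2 * N\<^sup>2 + (128 - 16 * N))"
      unfolding sum.distrib sum_distrib_left[symmetric] sum_const_UNIV sum_chi_dot_N
      using h h_sum_nonzero by (simp add: algebra_simps)
    then show ?thesis unfolding F_0 sum_at_zero by simp
  qed
  have "(\<Sum>a\<in>UNIV. \<Sum>c\<in>- {0, b}. F a c) = (N - 4) * (N * (16 * N - 192))"
    using quartic_sum_off_b[of 0 y0 2 "- (4 * N + 8)" "(N - 4)\<^sup>2 + N\<^sup>2" 0 8 "N\<^sup>2 - (N - 4)\<^sup>2"]
      y0_nonzero b_dot_y0 sum_F0
    unfolding F_poly card_A_flat rep by (simp add: zero_prod_def) (simp add: power2_eq_square power4_eq_xxxx algebra_simps)
  then have total: "(\<Sum>c\<in>- {0, b}. \<Sum>a\<in>UNIV. F a c) = (N - 4) * (N * (16 * N - 192))"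
    by (subst sum.swap)
  have "(\<Sum>c\<in>- {0, b}. 1 + chi (c \<odot> y0)) = N - 4"
  proof -
    have "(\<Sum>c\<in>UNIV. 1 + chi (c \<odot> y0)) = N"
      using sum_affine_chi[OF y0_nonzero, of 1 1] by simp
    moreover have "(\<Sum>c\<in>{0, b}. 1 + chi (c \<odot> y0)) = 4"
      using b_nonzero b_dot_y0 by simp
    ultimately show ?thesis
      using sum.subset_diff[of "{0, b}" UNIV "\<lambda>c. 1 + chi (c \<odot> y0)"] by (simp add: Compl_eq_Diff_UNIV)
  qed
  with total have excess: "(\<Sum>c\<in>- {0, b}. (\<Sum>a\<in>UNIV. F a c) - (1 + chi (c \<odot> y0)) * (N * (16 * N - 192))) = 0"
    by (simp add: sum_subtractf flip: sum_distrib_right)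
  have row: "0 \<le> (\<Sum>a\<in>UNIV. F a c) - (1 + chi (c \<odot> y0)) * (N * (16 * N - 192))" if "c \<in> - {0, b}" for c
  proof (cases "c \<odot> y0 = 0")
    case True
    then have "(\<Sum>a\<in>UNIV. F a c) = 2 * (\<Sum>a\<in>UNIV. ((T a c)\<^sup>2 - N)\<^sup>2)"
      by (simp add: F_def sum_distrib_left)
    then show ?thesis using row_energy(1)[OF _ _ True w w8 w8'] that True by simp
  next
    case False
    then have y: "c \<odot> y0 = 1" by simp
    have "0 \<le> P (T a c)" for a
    proof -
      have "4 dvd T a c - (N - 4) + 1 - (- 1)"
        using T_mod_4[of a c] y unfolding sigma_flat card_A_flat by simp
      then have "4 dvd T a c - (w - 2)" "4 dvd 2 * (w - 2)" using N_dvd w8 by presburger+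
      then show ?thesis unfolding P_def using w8' by (intro gap_poly_nonneg[where d = 4]) auto
    qed
    then show ?thesis using y by (simp add: F_def sum_nonneg)
  qed
  obtain a where a: "a \<odot> h1 = 1" using exists_dot_1[OF h(1)] by (metis dot_commute)
  have "(T a c)\<^sup>2 = N" if c: "c \<in> K y0" "c \<noteq> 0" for c
  proof -
    have cb: "c \<noteq> b" using c b_notin_K by metis
    have y: "c \<odot> y0 = 0" using c by (simp add: K_def)
    have "\<forall>c\<in>- {0, b}. (\<Sum>a\<in>UNIV. F a c) - (1 + chi (c \<odot> y0)) * (N * (16 * N - 192)) = 0"
      using excess row by (subst (asm) sum_nonneg_eq_0_iff) auto
    then have "(\<Sum>a\<in>UNIV. F a c) = 2 * (N * (16 * N - 192))"
      using c cb y by simp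
    then have "(\<Sum>a\<in>UNIV. ((T a c)\<^sup>2 - N)\<^sup>2) = N * (16 * N - 192)"
      using y by (simp add: F_def flip: sum_distrib_left)
    then show ?thesis using row_energy(2)[OF c(2) cb y w w8 w8'] a by blast
  qed
  moreover have "T a 0 = 0"
    using a unfolding T_0_flat by auto
  ultimately show False using nyberg[OF even_dim] by blast
qed

end

section \<open>Normalisation and the bound on the linearity\<close>

lemma apn_add_affine:
  assumes "apn F" "\<And>x h. L (x + h) + L x = D h"
  shows "apn (\<lambda>x. F x + L x)"
  unfolding apn_def
proof (intro allI impI)
  fix h y :: "bit ^ 'a" assume "h \<noteq> 0"
  have "F (x + h) + L (x + h) + (F x + L x) = y \<longleftrightarrow> F (x + h) + F x = y + D h" for x
  proof -
    have "F (x + h) + L (x + h) + (F x + L x) = F (x + h) + F x + D h"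
      unfolding assms(2)[of x h, symmetric] by (simp only: add_ac)
    then show ?thesis
      by (metis vec_add_self_right)
  qed
  then show "card {x. F (x + h) + L (x + h) + (F x + L x) = y} \<le> 2"
    using assms(1) \<open>h \<noteq> 0\<close> unfolding apn_def by simp
qed

lemma scale_add_left: "(k + l) *s x = k *s x + l *s (x :: bit ^ 'n)"
  by (simp add: vector_scalar_mult_def vec_eq_iff distrib_right)

lemma scale_0_1 [simp]: "0 *s x = (0 :: bit ^ 'n)" "1 *s x = (x :: bit ^ 'n)"
  by (simp_all add: vector_scalar_mult_def vec_eq_iff)

lemma sum_scale: "(\<Sum>x\<in>X. f x *s z) = (\<Sum>x\<in>X. f x) *s (z :: bit ^ 'n)"
  by (induction X rule: infinite_finite_induct) (simp_all add: scale_add_left)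

lemma scale_affine:
  "(a \<odot> (x + h) + t) *s z + (a \<odot> x + t) *s z = (a \<odot> h) *s (z :: bit ^ 'n)"
proof -
  have "a \<odot> (x + h) + t + (a \<odot> x + t) = (a \<odot> x + a \<odot> x) + (t + t) + a \<odot> h"
    by (simp only: dot_add_right add_ac)
  then show ?thesis
    unfolding scale_add_left[symmetric] by simp
qed

lemma sum_affine_UNIV:
  fixes a :: "bit ^ 'n"
  assumes "CARD('n) \<ge> 2"
  shows "(\<Sum>x\<in>UNIV. a \<odot> x + t) = 0"
proof -
  have "even (card (UNIV :: (bit ^ 'n) set))" using assms by simp
  then have "(\<Sum>x\<in>(UNIV :: (bit ^ 'n) set). t) = 0"
    by (cases t) simp_all
  then show ?thesis
    using sum_vec_UNIV[OF assms] by (simp add: sum.distrib flip: dot_sum_right)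
qed

text \<open>The graph is transformed by a linear map that fixes \<open>S\<close> and the component \<open>b \<odot> G\<close>. This gives the
freedom to move \<open>\<sigma>2\<close>.\<close>

lemma (in sparse_component) shear:
  assumes "b \<odot> z = 0"
  shows "sparse_component (\<lambda>x. G x + (d \<odot> x) *s z) b S N"
proof
  show "apn (\<lambda>x. G x + (d \<odot> x) *s z)"
    using apn scale_affine[of d _ _ 0 z] by (intro apn_add_affine) auto
  show "(\<Sum>x\<in>UNIV. G x + (d \<odot> x) *s z) = 0"
    using sum_affine_UNIV[of d 0] dim by (simp add: sum.distrib sum_scale sum_G)
  show "b \<odot> (G x + (d \<odot> x) *s z) = of_bool (x \<in> S)" for x
    by (simp add: dot_add_right dot_scale_right component assms)
qed (fact b_nonzero dim N_def)+

context sparse_component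
begin

lemma card_S_not_2: "card S \<noteq> 2"
proof
  assume "card S = 2"
  then obtain s t where S: "S = {s, t}" "s \<noteq> t" by (auto simp: card_2_iff)
  define z where "z = G s + G t"
  have "b \<odot> z = 0" using S by (simp add: z_def dot_add_right component)
  moreover obtain d where d: "(s + t) \<odot> d = 1"
    using exists_dot_1[of "s + t"] S(2) by (auto simp: vec_add_eq_0_iff)
  ultimately interpret H: sparse_component "\<lambda>x. G x + (d \<odot> x) *s z" b S N
    by (intro shear)
  have "(G s + (d \<odot> s) *s z) + (G t + (d \<odot> t) *s z) = z + (d \<odot> s + d \<odot> t) *s z"
    by (simp only: z_def scale_add_left add_ac)
  also have "d \<odot> s + d \<odot> t = 1" using d by (simp add: dot_commute dot_add_right)
  finally have "G s + (d \<odot> s) *s z = G t + (d \<odot> t) *s z"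
    by (simp add: vec_add_eq_0_iff)
  then show False using H.S_not_pair[OF S] by simp
qed

text \<open>If the points of \<open>S\<close> have a nonzero sum, one shear makes the sum of the values of \<open>G\<close> on \<open>S\<close>
vanish. If their sum is zero, two shears with dual functionals equalise three of the four values.\<close>

lemma card_S_not_4:
  assumes n: "even CARD('n)"
  shows "card S \<noteq> 4"
proof
  assume S: "card S = 4"
  show False
  proof (cases "(\<Sum>x\<in>S. x) = 0")
    case False
    define z where "z = (\<Sum>x\<in>S. G x)"
    have "b \<odot> z = (\<Sum>x\<in>S. 1)" unfolding z_def dot_sum_right by (intro sum.cong) (simp_all add: component)
    then have "b \<odot> z = 0" by (simp add: S)
    moreover obtain d where d: "(\<Sum>x\<in>S. x) \<odot> d = 1"
      using exists_dot_1[OF False] by blast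
    ultimately interpret H: sparse_component "\<lambda>x. G x + (d \<odot> x) *s z" b S N
      by (intro shear)
    have "(\<Sum>x\<in>S. G x + (d \<odot> x) *s z) = z + (\<Sum>x\<in>S. d \<odot> x) *s z"
      by (simp add: sum.distrib sum_scale z_def)
    also have "(\<Sum>x\<in>S. d \<odot> x) = 1"
      using d dot_commute[of d "\<Sum>x\<in>S. x"] dot_sum_right[of d "\<lambda>x. x" S] by simp
    finally have "H.\<sigma>2 = 0" unfolding H.\<sigma>2_def by simp
    then show False
      using H.S_not_quadruple S n False unfolding H.\<sigma>1_def by blast
  next
    case True
    obtain s q r t where S': "S = {s, q, r, t}" "distinct [s, q, r, t]"
      using S by (auto simp: card_Suc_eq numeral_eq_Suc)
    define h1 h2 where "h1 = s + q" and "h2 = s + r"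
    have h: "h1 \<noteq> 0" "h2 \<noteq> 0" "h1 \<noteq> h2"
      using S'(2) by (auto simp: h1_def h2_def vec_add_eq_0_iff)
    have "s + q + r + t = 0" using True S' by (simp add: add.assoc)
    then have "t = s + q + r" by (simp add: vec_add_eq_0_iff)
    also have "\<dots> = s + h1 + h2"
      unfolding h1_def h2_def by (simp add: add.left_commute[of q] add.assoc)
    finally have t: "t = s + h1 + h2" .
    have qr: "q = s + h1" "r = s + h2" by (simp_all add: h1_def h2_def)
    define z1 z2 where "z1 = G s + G q" and "z2 = G s + G r"
    have z: "b \<odot> z1 = 0" "b \<odot> z2 = 0" using S' by (simp_all add: z1_def z2_def dot_add_right component)
    obtain d1 where d1: "d1 \<odot> h1 = 1" "d1 \<odot> h2 = 0" using exists_dual[OF h] by blast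
    obtain d2 where d2: "d2 \<odot> h2 = 1" "d2 \<odot> h1 = 0" using exists_dual[OF h(2,1)] h(3) by blast
    define H where "H x = G x + (d1 \<odot> x) *s z1 + (d2 \<odot> x) *s z2" for x
    have "sparse_component H b S N"
      unfolding H_def using sparse_component.shear[OF shear[OF z(1)] z(2)] .
    then interpret H: sparse_component H b S N .
    have H_diff: "H (x + d) + H x = G (x + d) + G x + (d1 \<odot> d) *s z1 + (d2 \<odot> d) *s z2" for x d
    proof -
      have "H (x + d) + H x = G (x + d) + G x + ((d1 \<odot> (x + d) + 0) *s z1 + (d1 \<odot> x + 0) *s z1)
          + ((d2 \<odot> (x + d) + 0) *s z2 + (d2 \<odot> x + 0) *s z2)"
        unfolding H_def by (simp add: add_ac)
      then show ?thesis unfolding scale_affine .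
    qed
    have "H (s + h1) + H s = 0" "H (s + h2) + H s = 0"
      unfolding H_diff d1 d2 unfolding qr[symmetric] by (simp_all add: z1_def z2_def add.commute[of "G s"])
    then have "H (s + h1) = H s" "H (s + h2) = H s" by (simp_all add: vec_add_eq_0_iff)
    then interpret flat_component H b S N s h1 h2
      using h n S'(1) unfolding t qr[symmetric] by unfold_locales (simp_all add: t qr)
    show False by (rule contradiction)
  qed
qed

end

lemma walsh_eq: "walsh f a = (\<Sum>x\<in>UNIV. chi (f x + a \<odot> x))"
  unfolding walsh_def neg_one_power_of_bit ..

text \<open>The constant \<open>t\<close> makes the Walsh coefficient positive, so that \<open>S\<close> is the smaller of the two level
sets.\<close>

lemma exists_sparse_component:
  fixes F :: "bit ^ 'n \<Rightarrow> bit ^ 'n"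
  assumes n: "CARD('n) \<ge> 5" and F: "apn F" "(\<Sum>x\<in>UNIV. F x) = 0" and b: "b \<noteq> 0"
  obtains G S where "sparse_component G b S (2 ^ CARD('n))" "even (card S)"
    "\<bar>walsh (component_fun b F) a\<bar> = 2 ^ CARD('n) - 2 * int (card S)"
proof -
  define t :: bit where "t = (if walsh (component_fun b F) a < 0 then 1 else 0)"
  define g where "g x = b \<odot> F x + (a \<odot> x + t)" for x
  define S where "S = {x. g x = 1}"
  obtain e where e: "b \<odot> e = 1" using exists_dot_1[OF b] .
  define G where "G x = F x + (a \<odot> x + t) *s e" for x
  have bG: "b \<odot> G x = g x" for x
    by (simp add: G_def g_def dot_add_right dot_scale_right e)
  have sum_G: "(\<Sum>x\<in>UNIV. G x) = 0"
    using sum_affine_UNIV[of a t] n by (simp add: G_def sum.distrib sum_scale F(2))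
  interpret sparse_component G b S "2 ^ CARD('n)"
  proof
    show "apn G"
      unfolding G_def using F(1) scale_affine[of a _ _ t e] by (intro apn_add_affine) auto
    show "b \<odot> G x = of_bool (x \<in> S)" for x
      unfolding bG S_def by (cases "g x") simp_all
  qed (use b n sum_G in auto)
  have "\<bar>walsh (component_fun b F) a\<bar> = chi t * walsh (component_fun b F) a"
    by (simp add: t_def)
  also have "\<dots> = (\<Sum>x\<in>UNIV. chi (g x))"
    unfolding walsh_eq sum_distrib_left component_fun_def g_def by (intro sum.cong refl) (simp add: chi_add)
  also have "\<dots> = 2 ^ CARD('n) - 2 * int (card S)"
    using sum_chi_eq[OF finite, of g UNIV] by (simp add: S_def)
  finally have W: "\<bar>walsh (component_fun b F) a\<bar> = 2 ^ CARD('n) - 2 * int (card S)" .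
  have "(- 1 :: int) ^ card S = chi (\<Sum>x\<in>UNIV. b \<odot> G x)"
    by (simp add: chi_sum_bits bG S_def)
  also have "\<dots> = 1" using sum_G by (simp flip: dot_sum_right)
  finally have "even (card S)" by (cases "even (card S)") simp_all
  with W show ?thesis using that sparse_component_axioms by blast
qed

lemma linearity_bound:
  fixes F :: "bit ^ 'n \<Rightarrow> bit ^ 'n"
  assumes n: "CARD('n) \<ge> 5" and F: "apn F" "(\<Sum>x\<in>UNIV. F x) = 0"
  shows "linearity F \<le> (if even CARD('n) then 2 ^ CARD('n) - 12 else 2 ^ CARD('n) - 8)"
proof -
  have "\<bar>walsh (component_fun b F) a\<bar> \<le> (if even CARD('n) then 2 ^ CARD('n) - 12 else 2 ^ CARD('n) - 8)"
    if b: "b \<noteq> 0" for a b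
  proof -
    obtain G S where G: "sparse_component G b S (2 ^ CARD('n))" and S: "even (card S)"
      and W: "\<bar>walsh (component_fun b F) a\<bar> = 2 ^ CARD('n) - 2 * int (card S)"
      using exists_sparse_component[OF n F b] by blast
    interpret sparse_component G b S "2 ^ CARD('n)" by (fact G)
    have "card S \<noteq> 0" using S_nonempty by simp
    moreover note card_S_not_2 card_S_not_4
    ultimately have "(if even CARD('n) then 6 else 4) \<le> card S"
      using S by presburger
    then show ?thesis unfolding W by (auto split: if_splits)
  qed
  moreover have "finite {\<bar>walsh (component_fun b F) a\<bar> | a b. b \<noteq> 0}"
    by (rule finite_subset[of _ "(\<lambda>(a, b). \<bar>walsh (component_fun b F) a\<bar>) ` UNIV"]) auto
  moreover have "(axis undefined 1 :: bit ^ 'n) \<noteq> 0" by (simp add: axis_eq_0_iff)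
  then have "{\<bar>walsh (component_fun b F) a\<bar> | a b. b \<noteq> 0} \<noteq> {}" by blast
  ultimately show ?thesis
    unfolding linearity_def by (subst Max_le_iff) auto
qed

theorem corollary3p6:
  fixes F :: "bit ^ 'n \<Rightarrow> bit ^ 'n" and N :: int
  assumes n: "CARD('n) \<ge> 5"
    and N: "N = 2 ^ CARD('n)"
    and apn: "apn F"
  shows "((\<Sum>x\<in>UNIV. F x) = 0 \<longrightarrow>
            linearity F \<le> (if even CARD('n) then N - 12 else N - 8)) \<and>
         (bij F \<longrightarrow>
            linearity F \<le> (if even CARD('n) then N - 12 else N - 8))"
proof -
  have "(\<Sum>x\<in>UNIV. F x) = 0" if "bij F"
    using sum.reindex_bij_betw[OF that, of "\<lambda>x. x"] sum_vec_UNIV[where 'n = 'n] n by simp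
  then show ?thesis
    using linearity_bound[OF n apn] N by auto
qed

end
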